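(* For each $n\in\{0,1,2,\dots\}$ let $\bm P^{(n)}$ be a proper Beta Markov stick-breaking process with parameters $(N^{(n)},\bm\alpha^{(n)},\bm\beta^{(n)},P_0^{(n)})$ and weights $\bm w^{(n)}$, where: (H0) $N^{(0)}=0$ and $N^{(n)}\to\infty$; (H1) $\alpha^{(n)}_j\to\alpha_j>0$ and $\beta^{(n)}_j\to\beta_j>0$ as $n\to\infty$, for every $j\ge1$; (H2) with $F_j(v)=\mathcal I_v(\alpha_j,\beta_j)$ and $\Upsilon^{[j]}=F_j^{-1}\circ F_1$, one has $\sum_{j\ge1}\Upsilon^{[j]}(v)=\infty$ almost surely when $v\sim\mathrm{Beta}(\alpha_1,\beta_1)$; (H3) $P_0^{(n)}\to P_0$ weakly for some diffuse probability measure $P_0$. Then: (i) the length variables of $\bm P^{(0)}$ are independent with $v_j\sim\mathrm{Beta}(\alpha^{(0)}_j,\beta^{(0)}_j)$; in particular, if $\alpha^{(0)}_j=1-\sigma$ and $\beta^{(0)}_j=\theta+j\sigma$ with $0\le\sigma<1$, $\theta>-\sigma$, then $\bm P^{(0)}$ is a Pitman–Yor process. (ii) As $n\to\infty$, $\bm P^{(n)}\to\bm P$ weakly in distribution and $\bm w^{(n)}\to\bm w$ in distribution, where $\bm P$ is the completely dependent stick-breaking process with parameters $(\bm\pi,P_0)$, $\pi_j=\mathrm{Beta}(\alpha_j,\beta_j)$, and $\bm w$ its weights; in particular if $\alpha_j=1-\sigma$, $\beta_j=\theta+j\sigma$ with $0\le\sigma<1$, $\theta>-\sigma$, then $\bm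 w$ is a.s. non-increasing.
   Context: $\mathcal I_v(a,b)$ is the $\mathrm{Beta}(a,b)$ distribution function. Stick-breaking weights: $w_1=v_1$, $w_j=v_j\prod_{i<j}(1-v_i)$. A Beta Markov stick-breaking process with parameters $(N,\bm\alpha,\bm\beta,P_0)$ is $\bm P=\sum_jw_j\delta_{\theta_j}+(1-\sum_jw_j)P_0$ where $\bm v$ is a Markov chain with $v_1\sim\mathrm{Beta}(\alpha_1,\beta_1)$ and $\mathbb P[v_{j+1}\in du\mid v_j=v]=\sum_{z=0}^N\mathrm{Beta}(du\mid\alpha_{j+1}+z,\beta_{j+1}+N-z)\binom Nz\Upsilon_j(v)^z(1-\Upsilon_j(v))^{N-z}$, $\Upsilon_j=G_{j+1}^{-1}\circ G_j$ with $G_j(v)=\mathcal I_v(\alpha_j,\beta_j)$, $P_0$ diffuse on a complete separable metric space $\mathbb X$, and $\theta_j$ iid $P_0$ independent of $\bm w$. Proper: $\sum_jw_j=1$ a.s. The completely dependent stick-breaking process with parameters $(\bm\pi,P_0)$ (each $\pi_j$ with continuous strictly increasing distribution function $F_j$) uses $v_1\sim\pi_1$, $v_{j+1}=F_{j+1}^{-1}(F_j(v_j))$. The Pitman–Yor process corresponds to independent $v_j\sim\mathrm{Beta}(1-\sigma,\theta+j\sigma)$. $\bm P^{(n)}\to\bm P$ weakly in distribution means $\int f\,d\bm P^{(n)}\to\int f\,d\bm P$ in distribution for each bounded continuous $f$. *)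

theory Defs
  imports "HOL-Probability.Probability"
begin

text \<open>Indexing convention: all sequences are 0-based; index j here corresponds to
  index j+1 in the paper.\<close>

definition beta_density :: "real \<Rightarrow> real \<Rightarrow> real \<Rightarrow> real" where
  "beta_density a b x =
     (if 0 < x \<and> x < 1 then x powr (a - 1) * (1 - x) powr (b - 1) / Beta a b else 0)"

definition beta_measure :: "real \<Rightarrow> real \<Rightarrow> real measure" where
  "beta_measure a b = density lborel (\<lambda>x. ennreal (beta_density a b x))"

definition beta_cdf :: "real \<Rightarrow> real \<Rightarrow> real \<Rightarrow> real" where
  "beta_cdf a b v = measure (beta_measure a b) {..v}"

text \<open>Its inverse on [0,1] (the cdf is a continuous increasing bijection of [0,1]).\<close>
definition beta_quantile :: "real \<Rightarrow> real \<Rightarrow> real \<Rightarrow> real" where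
  "beta_quantile a b = inv_into {0..1} (beta_cdf a b)"

definition sb_weights :: "(nat \<Rightarrow> real) \<Rightarrow> nat \<Rightarrow> real" where
  "sb_weights v j = v j * (\<Prod>i<j. 1 - v i)"

definition sb_measure :: "'x::topological_space measure \<Rightarrow> (nat \<Rightarrow> real) \<Rightarrow> (nat \<Rightarrow> 'x) \<Rightarrow> 'x measure" where
  "sb_measure P0 w \<theta> = measure_of UNIV (sets borel)
     (\<lambda>A. (\<Sum>j. ennreal (w j) * indicator A (\<theta> j)) + ennreal (1 - (\<Sum>j. w j)) * emeasure P0 A)"

definition diffuse_prob :: "'x::topological_space measure \<Rightarrow> bool" where
  "diffuse_prob P0 \<longleftrightarrow> prob_space P0 \<and> sets P0 = sets borel \<and> (\<forall>x. emeasure P0 {x} = 0)"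

definition sb_atoms :: "'a measure \<Rightarrow> 'x::topological_space measure \<Rightarrow> (nat \<Rightarrow> 'a \<Rightarrow> real)
   \<Rightarrow> (nat \<Rightarrow> 'a \<Rightarrow> 'x) \<Rightarrow> bool" where
  "sb_atoms M P0 v \<theta> \<longleftrightarrow>
     (\<forall>j. \<theta> j \<in> measurable M borel) \<and>
     prob_space.indep_vars M (\<lambda>_. borel) \<theta> UNIV \<and>
     (\<forall>j. distr M borel (\<theta> j) = P0) \<and>
     prob_space.indep_set M
       (sets (vimage_algebra (space M) (\<lambda>\<omega> j. sb_weights (\<lambda>i. v i \<omega>) j) (PiM UNIV (\<lambda>_. borel))))
       (sets (vimage_algebra (space M) (\<lambda>\<omega> j. \<theta> j \<omega>) (PiM UNIV (\<lambda>_. borel))))"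

definition bm_Upsilon :: "(nat \<Rightarrow> real) \<Rightarrow> (nat \<Rightarrow> real) \<Rightarrow> nat \<Rightarrow> real \<Rightarrow> real" where
  "bm_Upsilon \<alpha> \<beta> j v = beta_quantile (\<alpha> (Suc j)) (\<beta> (Suc j)) (beta_cdf (\<alpha> j) (\<beta> j) v)"

definition bm_trans_density :: "nat \<Rightarrow> (nat \<Rightarrow> real) \<Rightarrow> (nat \<Rightarrow> real) \<Rightarrow> nat \<Rightarrow> real \<Rightarrow> real \<Rightarrow> real" where
  "bm_trans_density N \<alpha> \<beta> j v u =
     (\<Sum>z\<le>N. beta_density (\<alpha> (Suc j) + real z) (\<beta> (Suc j) + real (N - z)) u
              * real (N choose z) * bm_Upsilon \<alpha> \<beta> j v ^ z * (1 - bm_Upsilon \<alpha> \<beta> j v) ^ (N - z))"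

text \<open>v is a Markov chain with v_1 ~ Beta(alpha_1, beta_1) and the above transitions;
  expressed through its finite-dimensional distributions.\<close>
definition beta_markov_chain :: "'a measure \<Rightarrow> nat \<Rightarrow> (nat \<Rightarrow> real) \<Rightarrow> (nat \<Rightarrow> real)
   \<Rightarrow> (nat \<Rightarrow> 'a \<Rightarrow> real) \<Rightarrow> bool" where
  "beta_markov_chain M N \<alpha> \<beta> v \<longleftrightarrow>
     (\<forall>j. v j \<in> borel_measurable M) \<and>
     (\<forall>k. distr M (PiM {..k} (\<lambda>_. lborel)) (\<lambda>\<omega>. \<lambda>i\<in>{..k}. v i \<omega>) =
          density (PiM {..k} (\<lambda>_. lborel))
            (\<lambda>x. ennreal (beta_density (\<alpha> 0) (\<beta> 0) (x 0) *
                           (\<Prod>i<k. bm_trans_density N \<alpha> \<beta> i (x i) (x (Suc i))))))"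

definition beta_markov_sb :: "'a measure \<Rightarrow> nat \<Rightarrow> (nat \<Rightarrow> real) \<Rightarrow> (nat \<Rightarrow> real)
   \<Rightarrow> 'x::topological_space measure \<Rightarrow> (nat \<Rightarrow> 'a \<Rightarrow> real) \<Rightarrow> (nat \<Rightarrow> 'a \<Rightarrow> 'x) \<Rightarrow> bool" where
  "beta_markov_sb M N \<alpha> \<beta> P0 v \<theta> \<longleftrightarrow>
     prob_space M \<and> (\<forall>j. 0 < \<alpha> j \<and> 0 < \<beta> j) \<and> diffuse_prob P0 \<and>
     beta_markov_chain M N \<alpha> \<beta> v \<and> sb_atoms M P0 v \<theta>"

definition proper_sb :: "'a measure \<Rightarrow> (nat \<Rightarrow> 'a \<Rightarrow> real) \<Rightarrow> bool" where
  "proper_sb M v \<longleftrightarrow> (AE \<omega> in M. sb_weights (\<lambda>j. v j \<omega>) sums 1)"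

definition cd_beta_sb :: "'a measure \<Rightarrow> (nat \<Rightarrow> real) \<Rightarrow> (nat \<Rightarrow> real)
   \<Rightarrow> 'x::topological_space measure \<Rightarrow> (nat \<Rightarrow> 'a \<Rightarrow> real) \<Rightarrow> (nat \<Rightarrow> 'a \<Rightarrow> 'x) \<Rightarrow> bool" where
  "cd_beta_sb M \<alpha> \<beta> P0 v \<theta> \<longleftrightarrow>
     prob_space M \<and> diffuse_prob P0 \<and>
     v 0 \<in> borel_measurable M \<and> distr M lborel (v 0) = beta_measure (\<alpha> 0) (\<beta> 0) \<and>
     (\<forall>j \<omega>. v (Suc j) \<omega> = beta_quantile (\<alpha> (Suc j)) (\<beta> (Suc j)) (beta_cdf (\<alpha> j) (\<beta> j) (v j \<omega>))) \<and>
     sb_atoms M P0 v \<theta>"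

definition pitman_yor_sticks :: "'a measure \<Rightarrow> real \<Rightarrow> real \<Rightarrow> (nat \<Rightarrow> 'a \<Rightarrow> real) \<Rightarrow> bool" where
  "pitman_yor_sticks M \<sigma> \<tau> v \<longleftrightarrow>
     prob_space.indep_vars M (\<lambda>_. lborel) v UNIV \<and>
     (\<forall>j. distr M lborel (v j) = beta_measure (1 - \<sigma>) (\<tau> + real (Suc j) * \<sigma>))"

definition weak_conv_top :: "(nat \<Rightarrow> 'b::topological_space measure) \<Rightarrow> 'b measure \<Rightarrow> bool" where
  "weak_conv_top Ms M \<longleftrightarrow>
     (\<forall>f :: 'b \<Rightarrow> real. continuous_on UNIV f \<longrightarrow> bounded (range f) \<longrightarrow>
        (\<lambda>n. \<integral>x. f x \<partial>Ms n) \<longlonglongrightarrow> (\<integral>x. f x \<partial>M))"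

end

theory Submission
  imports Defs
begin

text \<open>Write \<open>F\<^sub>j\<close> for the limiting Beta distribution functions. Given \<open>v\<^sub>j\<close>, the mean-square distance
  of \<open>v\<^bsub>j+1\<^esub>\<close> to \<open>\<Upsilon>\<^sub>j v\<^sub>j\<close> is of order \<open>1/N\<close> uniformly in \<open>v\<^sub>j\<close>, because the binomial
  mixing variable divided by \<open>N\<close> concentrates at \<open>\<Upsilon>\<^sub>j v\<^sub>j\<close> and so do the Beta laws mixed. Hence on the
  \<open>n\<close>-th probability space itself every \<open>v\<^sub>j\<close> merges in probability with the same continuous function
  \<open>F\<^sub>j\<^bsup>-1\<^esup> \<circ> F\<^sub>0\<close> of the first length variable, whose law converges in total variation (Scheffe). Since the
  length variables live in the compact space of sequences in the unit interval, this gives weak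
  convergence of all weights jointly.

  For integrals \<open>\<integral>f dP\<close>, conditioning on the weights turns the characteristic function of the
  sum truncated at \<open>k\<close> terms into the expectation of \<open>\<Prod>\<^bsub>j<k\<^esub> \<phi>(t w\<^sub>j)\<close>, with \<open>\<phi>\<close> the characteristic function
  of \<open>f\<close> under the base measure; this is a continuous functional of the weights up to a uniformly
  small error, and the truncation error is controlled by the expected remaining mass, which also
  converges and is small in the limit by (H2). Levy's continuity theorem concludes.\<close>

subsection \<open>Beta distributions\<close>

text \<open>The processes for different n are not coupled and the limit process lives on an
  arbitrary space, so almost sure convergence is not at hand: each chain is compared with a function
  of its own first coordinate, and only the law of that coordinate passes to the limit. The atoms
  cannot be treated like this, because their laws converge only weakly. Characteristic functions
  remove them: the base measure then enters through \<open>\<phi>\<close> alone, and boundedness of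
  \<open>f\<close> makes all these functions Lipschitz with one constant, so that their pointwise
  convergence is uniform over the random arguments. Comparing products needs finitely many factors,
  hence the cut at k. Properness of the single processes gives no rate that is uniform in n, so k is
  chosen from the limit process alone and the estimate is carried back to all large n. The rate 1/N
  stems from a cancellation: in the second moment of the beta-binomial mixture about
  \<open>\<Upsilon>\<close>, the numerator loses its terms of order N^2 while the denominator keeps
  them.\<close>

lemma beta_density_nonneg: "0 < a \<Longrightarrow> 0 < b \<Longrightarrow> 0 \<le> beta_density a b x"
  by (simp add: beta_density_def Beta_def Gamma_real_pos less_imp_le)

lemma Beta_real_pos: "0 < a \<Longrightarrow> 0 < b \<Longrightarrow> 0 < Beta a (b::real)"
  by (simp add: Beta_def Gamma_real_pos)

lemma beta_density_pos: "0 < a \<Longrightarrow> 0 < b \<Longrightarrow> 0 < x \<Longrightarrow> x < 1 \<Longrightarrow> 0 < beta_density a b x"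
  by (simp add: beta_density_def Beta_real_pos)

lemma borel_measurable_beta_density [measurable]: "beta_density a b \<in> borel_measurable borel"
  unfolding beta_density_def[abs_def] by measurable

lemma nn_integral_beta_density:
  assumes "0 < a" "0 < b"
  shows "(\<integral>\<^sup>+x. ennreal (beta_density a b x) \<partial>lborel) = 1"
proof -
  have "((\<lambda>t. t powr (a - 1) * (1 - t) powr (b - 1) / Beta a b) has_integral Beta a b / Beta a b) {0..1}"
    using has_integral_Beta_real[OF assms] by (rule has_integral_divide)
  then have "((\<lambda>t. t powr (a - 1) * (1 - t) powr (b - 1) / Beta a b) has_integral 1) {0<..<1}"
    using Beta_real_pos[OF assms] by (simp add: has_integral_Icc_iff_Ioo)
  then have "((\<lambda>t. if t \<in> {0<..<1} then t powr (a - 1) * (1 - t) powr (b - 1) / Beta a b else 0) has_integral 1) UNIV"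
    by (simp only: has_integral_restrict_UNIV)
  also have "(\<lambda>t. if t \<in> {0<..<1} then t powr (a - 1) * (1 - t) powr (b - 1) / Beta a b else 0) = beta_density a b"
    by (auto simp: beta_density_def fun_eq_iff)
  finally show ?thesis
    using nn_integral_has_integral_lborel[of "beta_density a b" 1] beta_density_nonneg[OF assms] by simp
qed

lemma integrable_beta_density: "0 < a \<Longrightarrow> 0 < b \<Longrightarrow> integrable lborel (beta_density a b)"
  using nn_integral_beta_density[of a b] beta_density_nonneg[of a b]
  by (intro integrableI_nonneg) auto

lemma integral_beta_density: "0 < a \<Longrightarrow> 0 < b \<Longrightarrow> (\<integral>x. beta_density a b x \<partial>lborel) = 1"
  using nn_integral_beta_density[of a b] beta_density_nonneg[of a b]
  by (subst integral_eq_nn_integral) auto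

lemma sets_beta_measure [simp, measurable_cong]: "sets (beta_measure a b) = sets borel"
  by (simp add: beta_measure_def)

lemma space_beta_measure [simp]: "space (beta_measure a b) = UNIV"
  by (simp add: beta_measure_def)

lemma real_distribution_beta_measure:
  assumes "0 < a" "0 < b"
  shows "real_distribution (beta_measure a b)"
proof -
  have "prob_space (beta_measure a b)"
    by standard (simp add: beta_measure_def emeasure_density nn_integral_beta_density[OF assms])
  then show ?thesis
    by (simp add: real_distribution_def real_distribution_axioms_def)
qed

lemma AE_beta_measure: 
  assumes "0 < a" "0 < b"
  shows "AE x in beta_measure a b. 0 < x \<and> x < 1"
  unfolding beta_measure_def using beta_density_nonneg[OF assms]
  by (subst AE_density) (auto simp: beta_density_def)

lemma integral_beta_measure:
  fixes g :: "real \<Rightarrow> real"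
  assumes "0 < a" "0 < b" and [measurable]: "g \<in> borel_measurable borel"
  shows "(\<integral>x. g x \<partial>beta_measure a b) = (\<integral>x. beta_density a b x * g x \<partial>lborel)"
  unfolding beta_measure_def using beta_density_nonneg[OF assms(1,2)]
  by (subst integral_density) auto

section \<open>Distribution function and quantile function of a Beta law\<close>

lemma beta_cdf_eq_cdf: "beta_cdf a b v = cdf (beta_measure a b) v"
  by (simp add: beta_cdf_def cdf_def)

context
  fixes a b :: real
  assumes ab: "0 < a" "0 < b"
begin

interpretation B: real_distribution "beta_measure a b"
  by (rule real_distribution_beta_measure[OF ab])

lemma beta_cdf_mono: "x \<le> y \<Longrightarrow> beta_cdf a b x \<le> beta_cdf a b y"
  by (simp add: beta_cdf_eq_cdf B.cdf_nondecreasing)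

lemma beta_cdf_range: "0 \<le> beta_cdf a b x" "beta_cdf a b x \<le> 1"
  by (simp_all add: beta_cdf_eq_cdf B.cdf_nonneg B.cdf_bounded_prob)

lemma continuous_on_beta_cdf: "continuous_on S (beta_cdf a b)"
proof -
  have "emeasure (beta_measure a b) {x} = 0" for x
    by (simp add: beta_measure_def emeasure_density nn_integral_null_set)
  then have "isCont (cdf (beta_measure a b)) x" for x
    by (simp add: B.isCont_cdf measure_def)
  then show ?thesis
    by (simp add: beta_cdf_eq_cdf[abs_def] continuous_at_imp_continuous_on)
qed

lemma beta_cdf_0: "beta_cdf a b 0 = 0"
proof -
  have "B.prob {..0} = 0"
    using AE_beta_measure[OF ab] by (subst B.prob_eq_0) (auto elim: eventually_mono)
  then show ?thesis by (simp add: beta_cdf_def)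
qed

lemma beta_cdf_1: "beta_cdf a b 1 = 1"
proof -
  have "B.prob {..1} = 1"
    using AE_beta_measure[OF ab] by (subst B.prob_eq_1) (auto elim: eventually_mono)
  then show ?thesis by (simp add: beta_cdf_def)
qed

text \<open>Equal values would make the interval between x and y a null set of the Beta law; the
  density is positive there, so the interval would be Lebesgue null.\<close>

lemma beta_cdf_strict_mono:
  assumes "0 \<le> x" "x < y" "y \<le> 1"
  shows "beta_cdf a b x < beta_cdf a b y"
proof (rule ccontr)
  assume "\<not> ?thesis"
  then have eq: "beta_cdf a b x = beta_cdf a b y"
    using beta_cdf_mono[of x y] assms by simp
  have "B.prob {x<..y} = 0"
    using B.cdf_diff_eq[OF assms(2)] eq by (simp add: beta_cdf_eq_cdf)
  then have "AE u in beta_measure a b. u \<notin> {x<..y}"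
    by (subst (asm) B.prob_eq_0) auto
  \<comment> \<open>The right endpoint is dropped because \<open>y\<close> may be 1, where the
    density is 0.\<close>
  then have "AE u in lborel. u \<notin> {x<..<y}"
    unfolding beta_measure_def using beta_density_pos[OF ab] assms
    by (subst (asm) AE_density) (auto elim!: eventually_mono)
  then have "emeasure lborel {x<..<y} = 0"
    by (subst (asm) AE_iff_measurable[OF _ refl]) (auto simp: greaterThanLessThan_def greaterThan_def lessThan_def Int_def)
  then show False using assms by simp
qed

lemma bij_betw_beta_cdf: "bij_betw (beta_cdf a b) {0..1} {0..1}"
proof (rule bij_betw_imageI)
  show "inj_on (beta_cdf a b) {0..1}"
    by (rule linorder_inj_onI) (auto dest: beta_cdf_strict_mono)
  show "beta_cdf a b ` {0..1} = {0..1}"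
  proof (intro set_eqI iffI)
    fix y :: real assume "y \<in> {0..1}"
    then have "\<exists>x. 0 \<le> x \<and> x \<le> 1 \<and> beta_cdf a b x = y"
      by (intro IVT') (auto simp: beta_cdf_0 beta_cdf_1 continuous_on_beta_cdf)
    then show "y \<in> beta_cdf a b ` {0..1}" by auto
  qed (auto simp: beta_cdf_range)
qed

lemma beta_quantile_range:
  assumes "0 \<le> y" "y \<le> 1" shows "0 \<le> beta_quantile a b y" "beta_quantile a b y \<le> 1"
proof -
  have "y \<in> beta_cdf a b ` {0..1}"
    using assms bij_betw_beta_cdf by (simp add: bij_betw_def)
  from inv_into_into[OF this] show "0 \<le> beta_quantile a b y" "beta_quantile a b y \<le> 1"
    by (auto simp: beta_quantile_def)
qed

lemma beta_cdf_quantile: "0 \<le> y \<Longrightarrow> y \<le> 1 \<Longrightarrow> beta_cdf a b (beta_quantile a b y) = y"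
  using bij_betw_inv_into_right[OF bij_betw_beta_cdf] by (simp add: beta_quantile_def)

lemma beta_quantile_cdf: "0 \<le> x \<Longrightarrow> x \<le> 1 \<Longrightarrow> beta_quantile a b (beta_cdf a b x) = x"
  using bij_betw_inv_into_left[OF bij_betw_beta_cdf] by (simp add: beta_quantile_def)

text \<open>The inverse of a continuous injection on a compact set is continuous.\<close>

lemma continuous_on_beta_quantile: "continuous_on {0..1} (beta_quantile a b)"
proof -
  have "continuous_on (beta_cdf a b ` {0..1}) (beta_quantile a b)"
    by (rule continuous_on_inv) (auto simp: continuous_on_beta_cdf beta_quantile_cdf)
  then show ?thesis using bij_betw_beta_cdf by (simp add: bij_betw_def)
qed

lemma continuous_on_beta_quantile_comp:
  assumes "continuous_on S f" "\<And>x. x \<in> S \<Longrightarrow> 0 \<le> f x" "\<And>x. x \<in> S \<Longrightarrow> f x \<le> 1"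
  shows "continuous_on S (\<lambda>x. beta_quantile a b (f x))"
  by (rule continuous_on_compose2[OF continuous_on_beta_quantile assms(1)]) (use assms in auto)

end

section \<open>Monotonicity and continuity in the parameters\<close>

lemma measure_beta_measure:
  assumes "0 < a" "0 < b" "A \<in> sets borel"
  shows "measure (beta_measure a b) A = (\<integral>x. beta_density a b x * indicator A x \<partial>lborel)"
  using integral_beta_measure[of a b "indicator A"] assms by simp

text \<open>The density ratio of \<open>Beta(a, b')\<close> to \<open>Beta(a, b)\<close> is decreasing; comparing it with its
  value at \<open>x\<close> on both sides of \<open>x\<close> gives the stochastic order.\<close>

lemma beta_cdf_mono_snd:
  assumes "0 < a" "0 < b" "b \<le> b'"
  shows "beta_cdf a b x \<le> beta_cdf a b' x"
proof -
  have b': "0 < b'" using assms by simp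
  interpret B: real_distribution "beta_measure a b"
    by (rule real_distribution_beta_measure) fact+
  interpret B': real_distribution "beta_measure a b'"
    by (rule real_distribution_beta_measure) fact+
  consider "x \<le> 0" | "1 \<le> x" | "0 < x" "x < 1" by linarith
  then show ?thesis
  proof cases
    case 1
    then show ?thesis
      using beta_cdf_mono[OF assms(1,2) 1] beta_cdf_0[OF assms(1,2)] beta_cdf_range[OF assms(1) b', of x] by linarith
  next
    case 2
    then show ?thesis
      using beta_cdf_mono[OF assms(1) b' 2] beta_cdf_1[OF assms(1) b'] beta_cdf_range[OF assms(1,2), of x] by linarith
  next
    case 3
    define r where "r u = Beta a b / Beta a b' * (1 - u) powr (b' - b)" for u
    have pos: "0 < Beta a b" "0 < Beta a b'"
      using assms b' by (auto intro: Beta_real_pos)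
    have ratio: "beta_density a b' u = r u * beta_density a b u" for u
      using pos by (auto simp: beta_density_def r_def field_simps simp flip: powr_add)
    have le: "r x * beta_density a b u \<le> beta_density a b' u" if "u \<le> x" for u
      unfolding ratio r_def using that 3 assms pos
      by (intro mult_right_mono mult_left_mono powr_mono2) (auto simp: beta_density_nonneg)
    have ge: "beta_density a b' u \<le> r x * beta_density a b u" if "x < u" for u
    proof (cases "u < 1")
      case True
      then show ?thesis
        unfolding ratio r_def using that 3 assms pos
        by (intro mult_right_mono mult_left_mono powr_mono2) (auto simp: beta_density_nonneg)
    qed (simp add: beta_density_def)
    have int: "integrable lborel (\<lambda>u. c * (beta_density a d u * indicator A u))"
      if "A \<in> sets borel" "0 < d" for A c d
      using integrable_mult_indicator[of A lborel "beta_density a d"] integrable_beta_density[OF assms(1) that(2)] that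
      by (simp add: mult.commute)
    have "r x * measure (beta_measure a b) {..x} \<le> measure (beta_measure a b') {..x}"
      using int[of "{..x}" b "r x"] int[of "{..x}" b' 1] assms b' le
      by (simp add: measure_beta_measure) 
         (subst integral_mult_right_zero[symmetric], rule integral_mono, auto simp: indicator_def)
    moreover have "measure (beta_measure a b') {x<..} \<le> r x * measure (beta_measure a b) {x<..}"
      using int[of "{x<..}" b "r x"] int[of "{x<..}" b' 1] assms b' ge
      by (simp add: measure_beta_measure) 
         (subst integral_mult_right_zero[symmetric], rule integral_mono, auto simp: indicator_def)
    moreover have "measure (beta_measure a d) {x<..} = 1 - beta_cdf a d x" if "prob_space (beta_measure a d)" for d
      using prob_space.prob_compl[OF that, of "{..x}"] by (simp add: beta_cdf_def Compl_eq_Diff_UNIV[symmetric])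
    ultimately have *: "r x * beta_cdf a b x \<le> beta_cdf a b' x" "1 - beta_cdf a b' x \<le> r x * (1 - beta_cdf a b x)"
      using B.prob_space_axioms B'.prob_space_axioms by (auto simp: beta_cdf_def)
    \<comment> \<open>Multiplying the first estimate by 1 - F and the second by F eliminates the
      factor \<open>r x\<close>, where F and F' are the two distribution functions at x. This leaves
      (1 - F') F <= F' (1 - F), in which the product F F' cancels.\<close>
    have "(1 - beta_cdf a b' x) * beta_cdf a b x \<le> (r x * (1 - beta_cdf a b x)) * beta_cdf a b x"
      using * beta_cdf_range[OF assms(1,2)] by (intro mult_right_mono) auto
    also have "\<dots> = (r x * beta_cdf a b x) * (1 - beta_cdf a b x)" by simp
    also have "\<dots> \<le> beta_cdf a b' x * (1 - beta_cdf a b x)"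
      using * beta_cdf_range[OF assms(1,2)] by (intro mult_right_mono) auto
    finally show ?thesis by (simp add: algebra_simps)
  qed
qed

text \<open>Size biasing: a factor u raises the first parameter by one, and the constant is the
  ratio of the normalisations. Moments of Beta laws then follow from the total mass being 1.\<close>

lemma beta_density_shift:
  assumes "0 < a" "0 < b"
  shows "u * beta_density a b u = a / (a + b) * beta_density (a + 1) b u"
proof -
  have "(a + b) * Beta (a + 1) b = a * Beta a b"
    using assms by (intro Beta_plus1_left) (auto simp: nonpos_Ints_def)
  then have "Beta (a + 1) b = a * Beta a b / (a + b)"
    using assms by (simp add: field_simps)
  moreover have "u * u powr (a - 1) = u powr a" if "0 < u"
    using that by (simp add: powr_mult_base)
  ultimately show ?thesis
    using assms Beta_real_pos[OF assms] by (simp add: beta_density_def)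
qed

lemma beta_density_limit:
  assumes "(\<lambda>n. as n) \<longlonglongrightarrow> a" "(\<lambda>n. bs n) \<longlonglongrightarrow> b" "0 < a" "0 < b"
  shows "(\<lambda>n. beta_density (as n) (bs n) x) \<longlonglongrightarrow> beta_density a b x"
proof (cases "0 < x \<and> x < 1")
  case True
  have "(\<lambda>n. x powr (as n - 1) * (1 - x) powr (bs n - 1) / Beta (as n) (bs n)) \<longlonglongrightarrow> 
      x powr (a - 1) * (1 - x) powr (b - 1) / Beta a b"
    using True assms Beta_real_pos[OF assms(3,4)] unfolding Beta_def
    by (intro tendsto_intros assms) (auto simp: Gamma_eq_zero_iff nonpos_Ints_def)
  then show ?thesis using True by (simp add: beta_density_def)
qed (auto simp: beta_density_def)

text \<open>Scheffe: densities of total mass 1 that converge pointwise converge in L1. This one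
  quantity later bounds both the uniform distance of distribution functions and the differences of
  integrals of bounded functions.\<close>

lemma beta_density_L1_limit:
  assumes "as \<longlonglongrightarrow> a" "bs \<longlonglongrightarrow> b" "0 < a" "0 < b" "\<And>n. 0 < as n" "\<And>n. 0 < bs n"
  shows "(\<lambda>n. \<integral>x. \<bar>beta_density (as n) (bs n) x - beta_density a b x\<bar> \<partial>lborel) \<longlonglongrightarrow> 0"
proof -
  have "(\<lambda>n. \<integral>\<^sup>+x. norm (beta_density (as n) (bs n) x - beta_density a b x) \<partial>lborel) \<longlonglongrightarrow> 0"
    by (rule Scheffe_lemma2)
       (auto intro!: beta_density_limit assms integrable_beta_density
          simp: beta_density_nonneg assms nn_integral_beta_density)
  moreover have "(\<integral>\<^sup>+x. norm (beta_density (as n) (bs n) x - beta_density a b x) \<partial>lborel) = 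
    ennreal (\<integral>x. \<bar>beta_density (as n) (bs n) x - beta_density a b x\<bar> \<partial>lborel)" for n
    by (subst nn_integral_eq_integral) (auto intro!: integrable_beta_density assms)
  ultimately show ?thesis
    by (simp add: ennreal_tendsto_0_iff)
qed

lemma beta_measure_integral_diff:
  fixes g :: "real \<Rightarrow> real"
  assumes "0 < a" "0 < b" "0 < a'" "0 < b'" and [measurable]: "g \<in> borel_measurable borel" and "\<And>x. \<bar>g x\<bar> \<le> C"
  shows "\<bar>(\<integral>x. g x \<partial>beta_measure a b) - (\<integral>x. g x \<partial>beta_measure a' b')\<bar>
    \<le> C * (\<integral>x. \<bar>beta_density a b x - beta_density a' b' x\<bar> \<partial>lborel)"
proof -
  have int: "integrable lborel (\<lambda>x. beta_density a b x * g x)" if "0 < a" "0 < b" for a b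
  proof (rule Bochner_Integration.integrable_bound)
    show "integrable lborel (\<lambda>x. beta_density a b x * C)"
      by (simp add: integrable_beta_density that)
    have "\<bar>g x\<bar> \<le> \<bar>C\<bar>" for x
      using assms(6)[of x] by simp
    then show "AE x in lborel. norm (beta_density a b x * g x) \<le> norm (beta_density a b x * C)"
      by (intro AE_I2) (simp add: abs_mult mult_left_mono)
  qed simp
  have "\<bar>(\<integral>x. g x \<partial>beta_measure a b) - (\<integral>x. g x \<partial>beta_measure a' b')\<bar> = 
    \<bar>\<integral>x. (beta_density a b x - beta_density a' b' x) * g x \<partial>lborel\<bar>"
    by (simp add: integral_beta_measure assms int left_diff_distrib)
  also have "\<dots> \<le> (\<integral>x. \<bar>(beta_density a b x - beta_density a' b' x) * g x\<bar> \<partial>lborel)"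
    by (rule integral_abs_bound)
  also have "\<dots> \<le> (\<integral>x. C * \<bar>beta_density a b x - beta_density a' b' x\<bar> \<partial>lborel)"
  proof (rule integral_mono)
    show "integrable lborel (\<lambda>x. \<bar>(beta_density a b x - beta_density a' b' x) * g x\<bar>)"
      using int[OF assms(1,2)] int[OF assms(3,4)] by (simp add: left_diff_distrib)
  qed (use assms in \<open>auto simp: abs_mult mult.commute[of C] intro!: integrable_beta_density mult_left_mono\<close>)
  finally show ?thesis by simp
qed

lemma beta_cdf_diff:
  assumes "0 < a" "0 < b" "0 < a'" "0 < b'"
  shows "\<bar>beta_cdf a b x - beta_cdf a' b' x\<bar> \<le> (\<integral>x. \<bar>beta_density a b x - beta_density a' b' x\<bar> \<partial>lborel)"
  using beta_measure_integral_diff[OF assms, of "indicator {..x}" 1]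
  by (simp add: beta_cdf_def)

subsection \<open>The transitions of the Beta Markov chain\<close>

text \<open>Expand the square and apply size biasing once to u and twice to u^2. The centre
  \<open>y\<close> is arbitrary, not the mean, because all components of a mixture will be measured
  from the same point.\<close>

lemma beta_second_moment:
  fixes y :: real
  assumes "0 < a" "0 < b"
  shows "has_bochner_integral lborel (\<lambda>u. beta_density a b u * (u - y)\<^sup>2)
    (a * (a + 1) / ((a + b) * (a + b + 1)) - 2 * y * (a / (a + b)) + y\<^sup>2)"
proof -
  have hb: "has_bochner_integral lborel (beta_density a b) 1" if "0 < a" "0 < b" for a b
    using integrable_beta_density[OF that] integral_beta_density[OF that] by (simp add: has_bochner_integral_iff)
  have eq: "beta_density a b u * (u - y)\<^sup>2 =
      a / (a + b) * ((a + 1) / (a + 1 + b) * beta_density (a + 1 + 1) b u)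
      - 2 * y * (a / (a + b) * beta_density (a + 1) b u) + y\<^sup>2 * beta_density a b u" for u
  proof -
    have "u * (u * beta_density a b u) = a / (a + b) * (u * beta_density (a + 1) b u)"
      using beta_density_shift[OF assms, of u] by (simp add: mult.left_commute)
    also have "\<dots> = a / (a + b) * ((a + 1) / (a + 1 + b) * beta_density (a + 1 + 1) b u)"
      using assms by (subst beta_density_shift) auto
    finally have "beta_density a b u * (u - y)\<^sup>2 = a / (a + b) * ((a + 1) / (a + 1 + b) * beta_density (a + 1 + 1) b u)
      - 2 * y * (u * beta_density a b u) + y\<^sup>2 * beta_density a b u"
      by (simp add: power2_eq_square algebra_simps)
    then show ?thesis
      by (simp only: beta_density_shift[OF assms, of u])
  qed
  have "has_bochner_integral lborel (\<lambda>u. beta_density a b u * (u - y)\<^sup>2)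
    (a / (a + b) * ((a + 1) / (a + 1 + b) * 1) - 2 * y * (a / (a + b) * 1) + y\<^sup>2 * 1)"
    unfolding eq using assms
    by (intro has_bochner_integral_add has_bochner_integral_diff has_bochner_integral_mult_right hb) auto
  then show ?thesis by (simp add: algebra_simps)
qed

text \<open>The mixing weights are Bernstein polynomials at y. All components share the parameter
  sum a + b + N, so their second moments about y form a quadratic polynomial in z, which the
  Bernstein identities for 1, z and z (z - 1) sum up.\<close>

lemma beta_binomial_mixture_second_moment:
  fixes a b y :: real
  assumes ab: "0 < a" "0 < b" and y: "0 \<le> y" "y \<le> 1" and N: "1 \<le> N"
  shows "(\<integral>\<^sup>+u. ennreal ((\<Sum>z\<le>N. beta_density (a + real z) (b + real (N - z)) u
              * real (N choose z) * y ^ z * (1 - y) ^ (N - z)) * (u - y)\<^sup>2) \<partial>lborel)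
     \<le> ennreal ((2 * real N + 2 * (a + b + 1)\<^sup>2) / (real N)\<^sup>2)"
proof -
  define s where "s = a + b + real N"
  define p where "p = 1 / (s * (s + 1))"
  \<comment> \<open>\<open>p\<close>, \<open>q\<close> and \<open>r\<close> are the coefficients of
    that polynomial in the basis z (z - 1), z, 1; the 2 a + 2 comes from (a + z) (a + z + 1) = z (z
    - 1) + (2 a + 2) z + a (a + 1).\<close>
  define q where "q = (2 * a + 2) * p - 2 * y / s"
  define r where "r = a * (a + 1) * p - 2 * y * a / s + y\<^sup>2"
  have s: "0 < s" using ab by (simp add: s_def)
  have summand: "has_bochner_integral lborel
      (\<lambda>u. Bernstein N z y * (beta_density (a + real z) (b + real (N - z)) u * (u - y)\<^sup>2))
      (p * (real z * (real z - 1) * Bernstein N z y) + q * (real z * Bernstein N z y) + r * Bernstein N z y)"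
    if "z \<in> {..N}" for z
  proof -
    have sum: "a + real z + (b + real (N - z)) = s"
      using that by (simp add: s_def of_nat_diff)
    have "has_bochner_integral lborel
        (\<lambda>u. Bernstein N z y * (beta_density (a + real z) (b + real (N - z)) u * (u - y)\<^sup>2))
        (Bernstein N z y * ((a + real z) * (a + real z + 1) / (s * (s + 1)) - 2 * y * ((a + real z) / s) + y\<^sup>2))"
      using ab beta_second_moment[of "a + real z" "b + real (N - z)" y, unfolded sum]
      by (intro has_bochner_integral_mult_right) (auto simp: add_pos_nonneg)
    moreover have "Bernstein N z y * ((a + real z) * (a + real z + 1) / (s * (s + 1)) - 2 * y * ((a + real z) / s) + y\<^sup>2)
      = p * (real z * (real z - 1) * Bernstein N z y) + q * (real z * Bernstein N z y) + r * Bernstein N z y"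
    proof -
      have "(a + real z) * (a + real z + 1) / (s * (s + 1)) = (a + real z) * (a + real z + 1) * p"
        "2 * y * ((a + real z) / s) = 2 * y * (a + real z) * (1 / s)"
        by (simp_all add: p_def)
      then show ?thesis
        by (simp only:) (simp add: q_def r_def divide_inverse ring_distribs power2_eq_square algebra_simps)
    qed
    ultimately show ?thesis by simp
  qed
  have "has_bochner_integral lborel (\<lambda>u. \<Sum>z\<le>N. Bernstein N z y * (beta_density (a + real z) (b + real (N - z)) u * (u - y)\<^sup>2))
    (\<Sum>z\<le>N. p * (real z * (real z - 1) * Bernstein N z y) + q * (real z * Bernstein N z y) + r * Bernstein N z y)"
    by (rule has_bochner_integral_sum) (rule summand)
  also have "(\<Sum>z\<le>N. p * (real z * (real z - 1) * Bernstein N z y) + q * (real z * Bernstein N z y) + r * Bernstein N z y)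
     = p * (real N * (real N - 1) * y\<^sup>2) + q * (real N * y) + r"
    by (simp only: sum.distrib sum_distrib_left[symmetric] sum_kk_Bernstein sum_k_Bernstein sum_Bernstein mult_1_right)
  also have "\<dots> = (real N * (real N - 1) * y\<^sup>2 + (2 * a + 2) * real N * y - 2 * y\<^sup>2 * real N * (s + 1)
        + a * (a + 1) - 2 * y * a * (s + 1) + y\<^sup>2 * (s * (s + 1))) * p"
  proof -
    have p: "1 / s = (s + 1) * p" "s * (s + 1) * p = 1"
      using s by (simp_all add: p_def)
    have "q = (2 * a + 2) * p - 2 * y * ((s + 1) * p)"
      by (simp add: q_def flip: p(1))
    moreover have "r = a * (a + 1) * p - 2 * y * a * ((s + 1) * p) + y\<^sup>2 * (s * (s + 1) * p)"
      unfolding p(2) by (simp add: r_def flip: p(1))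
    ultimately show ?thesis
      by (simp only:) (simp add: algebra_simps power2_eq_square)
  qed
  \<comment> \<open>Substituting \<open>s\<close> makes the terms quadratic in \<open>real N\<close>
    cancel, with coefficients 1 - 2 + 1 times y^2. The numerator is now of order N, against
    \<open>p\<close> of order 1/N^2.\<close>
  also have "\<dots> = (2 * real N * (y * (1 - y)) + a * (a + 1) - 2 * y * a * (a + b + 1)
         + y\<^sup>2 * ((a + b) * (a + b + 1))) * p"
    by (simp add: s_def algebra_simps power2_eq_square)
  finally have int: "has_bochner_integral lborel 
    (\<lambda>u. \<Sum>z\<le>N. Bernstein N z y * (beta_density (a + real z) (b + real (N - z)) u * (u - y)\<^sup>2))
    ((2 * real N * (y * (1 - y)) + a * (a + 1) - 2 * y * a * (a + b + 1)
         + y\<^sup>2 * ((a + b) * (a + b + 1))) * p)" (is "has_bochner_integral _ ?f (?A * p)") .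
  \<comment> \<open>The negative term is dropped, and \<open>(a + b + 1)\<^sup>2\<close> bounds both
    remaining products of parameters; hence its factor 2 in the final constant.\<close>
  have "?A \<le> 2 * real N * 1 + (a + b + 1)\<^sup>2 - 0 + 1 * (a + b + 1)\<^sup>2"
  proof (intro add_mono diff_mono mult_mono)
    show "y * (1 - y) \<le> 1" using y by (simp add: mult_le_one)
    show "a * (a + 1) \<le> (a + b + 1)\<^sup>2" "(a + b) * (a + b + 1) \<le> (a + b + 1)\<^sup>2"
      unfolding power2_eq_square using ab by (auto intro!: mult_mono)
    show "y\<^sup>2 \<le> 1" using y by (simp add: power_le_one)
  qed (use ab y in auto)
  then have A: "?A \<le> 2 * real N + 2 * (a + b + 1)\<^sup>2" by simp
  have "(real N)\<^sup>2 \<le> s * (s + 1)"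
    unfolding power2_eq_square using ab by (intro mult_mono) (auto simp: s_def)
  then have "p \<le> 1 / (real N)\<^sup>2"
    unfolding p_def using N s by (intro divide_left_mono mult_pos_pos) auto
  then have "?A * p \<le> (2 * real N + 2 * (a + b + 1)\<^sup>2) * (1 / (real N)\<^sup>2)"
    using A s by (intro mult_mono) (auto simp: p_def)
  moreover have "(\<integral>\<^sup>+u. ennreal (?f u) \<partial>lborel) = ennreal (?A * p)"
  proof -
    have "0 \<le> ?f u" for u
      using ab y by (intro sum_nonneg mult_nonneg_nonneg Bernstein_nonneg beta_density_nonneg) (auto simp: add_pos_nonneg)
    then have "(\<integral>\<^sup>+u. ennreal (?f u) \<partial>lborel) = ennreal (\<integral>u. ?f u \<partial>lborel)"
      using int by (intro nn_integral_eq_integral AE_I2) (simp_all only: has_bochner_integral_iff)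
    then show ?thesis using int by (simp only: has_bochner_integral_iff)
  qed
  moreover have "(\<Sum>z\<le>N. beta_density (a + real z) (b + real (N - z)) u
              * real (N choose z) * y ^ z * (1 - y) ^ (N - z)) * (u - y)\<^sup>2 = ?f u" for u
    unfolding sum_distrib_right by (intro sum.cong) (simp_all add: Bernstein_def)
  ultimately show ?thesis
    by (simp only:) (rule ennreal_leI, simp)
qed

section \<open>Transition densities and finite-dimensional laws of the chain\<close>

lemma bm_Upsilon_range:
  assumes "\<And>j. 0 < \<alpha> j" "\<And>j. 0 < \<beta> j"
  shows "0 \<le> bm_Upsilon \<alpha> \<beta> j x" "bm_Upsilon \<alpha> \<beta> j x \<le> 1"
  unfolding bm_Upsilon_def using assms by (auto intro!: beta_quantile_range beta_cdf_range)

lemma continuous_on_bm_Upsilon: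
  assumes "\<And>j. 0 < \<alpha> j" "\<And>j. 0 < \<beta> j"
  shows "continuous_on UNIV (bm_Upsilon \<alpha> \<beta> j)"
  unfolding bm_Upsilon_def[abs_def] using assms
  by (intro continuous_on_beta_quantile_comp continuous_on_beta_cdf beta_cdf_range)

lemma borel_measurable_bm_trans_density:
  assumes "\<And>j. 0 < \<alpha> j" "\<And>j. 0 < \<beta> j"
  assumes [measurable]: "f \<in> borel_measurable M" "g \<in> borel_measurable M"
  shows "(\<lambda>x. bm_trans_density N \<alpha> \<beta> j (f x) (g x)) \<in> borel_measurable M"
proof -
  have [measurable]: "bm_Upsilon \<alpha> \<beta> j \<in> borel_measurable borel"
    by (rule borel_measurable_continuous_onI[OF continuous_on_bm_Upsilon[OF assms(1,2)]])
  show ?thesis unfolding bm_trans_density_def by measurable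
qed

lemma bm_trans_density_nonneg:
  assumes "\<And>j. 0 < \<alpha> j" "\<And>j. 0 < \<beta> j"
  shows "0 \<le> bm_trans_density N \<alpha> \<beta> j x u"
  unfolding bm_trans_density_def using assms bm_Upsilon_range[OF assms]
  by (intro sum_nonneg mult_nonneg_nonneg) (auto intro!: beta_density_nonneg add_pos_nonneg)

lemma bm_trans_density_support:
  "bm_trans_density N \<alpha> \<beta> j x u \<noteq> 0 \<Longrightarrow> 0 < u \<and> u < 1"
  by (rule ccontr) (auto simp: bm_trans_density_def beta_density_def)

text \<open>Integrating out the last coordinate of the joint density leaves the mixture moment
  centred at \<open>bm_Upsilon\<close> of the previous state. Its bound is the same for every state,
  so the density of the earlier coordinates integrates to 1 against it.\<close>

lemma beta_markov_chain_step:
  assumes chain: "beta_markov_chain M N \<alpha> \<beta> v" and pos: "\<And>j. 0 < \<alpha> j" "\<And>j. 0 < \<beta> j"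
    and M: "prob_space M" and N: "1 \<le> N"
  shows "(\<integral>\<^sup>+\<omega>. ennreal ((v (Suc j) \<omega> - bm_Upsilon \<alpha> \<beta> j (v j \<omega>))\<^sup>2) \<partial>M)
     \<le> ennreal ((2 * real N + 2 * (\<alpha> (Suc j) + \<beta> (Suc j) + 1)\<^sup>2) / (real N)\<^sup>2)" (is "_ \<le> ?C")
proof -
  interpret prob_space M by fact
  interpret L: product_sigma_finite "\<lambda>_::nat. lborel :: real measure"
    by standard
  have [measurable]: "v i \<in> borel_measurable M" for i
    using chain by (simp add: beta_markov_chain_def)
  have [measurable]: "bm_Upsilon \<alpha> \<beta> j \<in> borel_measurable borel" for j
    by (rule borel_measurable_continuous_onI[OF continuous_on_bm_Upsilon[OF pos]])
  define D where "D k x = beta_density (\<alpha> 0) (\<beta> 0) (x 0) *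
                           (\<Prod>i<k. bm_trans_density N \<alpha> \<beta> i (x i) (x (Suc i)))" for k :: nat and x :: "nat \<Rightarrow> real"
  have [measurable]: "D k \<in> borel_measurable (PiM {..k} (\<lambda>_. lborel))" for k
    unfolding D_def by (measurable; (intro borel_measurable_bm_trans_density pos)?; measurable)
  \<comment> \<open>The index set is written as an insertion to fit the Fubini rule that splits off
    coordinate \<open>Suc j\<close>.\<close>
  then have [measurable]: "D (Suc j) \<in> borel_measurable (PiM (insert (Suc j) {..j}) (\<lambda>_. lborel))"
    unfolding atMost_Suc[symmetric] .
  have D_nonneg: "0 \<le> D k x" for k x
    unfolding D_def using pos
    by (intro mult_nonneg_nonneg prod_nonneg) (auto intro!: beta_density_nonneg bm_trans_density_nonneg)
  have distr: "distr M (PiM {..k} (\<lambda>_. lborel)) (\<lambda>\<omega>. \<lambda>i\<in>{..k}. v i \<omega>) = 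
      density (PiM {..k} (\<lambda>_. lborel)) (\<lambda>x. ennreal (D k x))" for k
    using chain by (simp add: beta_markov_chain_def D_def)
  have rest [measurable]: "(\<lambda>\<omega>. \<lambda>i\<in>{..k}. v i \<omega>) \<in> measurable M (PiM {..k} (\<lambda>_. lborel))" for k
    by (rule measurable_restrict) simp
  \<comment> \<open>The total mass is read off from the law of the chain; the product of densities
    is never integrated.\<close>
  have D_int: "(\<integral>\<^sup>+x. ennreal (D k x) \<partial>PiM {..k} (\<lambda>_. lborel)) = 1" for k
  proof -
    have "prob_space (density (PiM {..k} (\<lambda>_. lborel)) (\<lambda>x. ennreal (D k x)))"
      unfolding distr[symmetric] by (rule prob_space_distr) (rule rest)
    then show ?thesis
      using prob_space.emeasure_space_1[of "density (PiM {..k} (\<lambda>_. lborel)) (\<lambda>x. ennreal (D k x))"]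
      by (simp add: emeasure_density cong: nn_integral_cong)
  qed
  have "(\<integral>\<^sup>+\<omega>. ennreal ((v (Suc j) \<omega> - bm_Upsilon \<alpha> \<beta> j (v j \<omega>))\<^sup>2) \<partial>M) = 
     (\<integral>\<^sup>+x. ennreal ((x (Suc j) - bm_Upsilon \<alpha> \<beta> j (x j))\<^sup>2) \<partial>distr M (PiM {..Suc j} (\<lambda>_. lborel)) (\<lambda>\<omega>. \<lambda>i\<in>{..Suc j}. v i \<omega>))"
    by (subst nn_integral_distr) auto
  also have "\<dots> = (\<integral>\<^sup>+x. ennreal (D (Suc j) x * (x (Suc j) - bm_Upsilon \<alpha> \<beta> j (x j))\<^sup>2) \<partial>PiM (insert (Suc j) {..j}) (\<lambda>_. lborel))"
    unfolding distr by (subst nn_integral_density) (auto simp: atMost_Suc ennreal_mult' D_nonneg)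
  also have "\<dots> = (\<integral>\<^sup>+x. (\<integral>\<^sup>+u. ennreal (D j x) * ennreal (bm_trans_density N \<alpha> \<beta> j (x j) u * (u - bm_Upsilon \<alpha> \<beta> j (x j))\<^sup>2) \<partial>lborel)
       \<partial>PiM {..j} (\<lambda>_. lborel))"
  proof (subst L.product_nn_integral_insert)
    show "(\<lambda>x. ennreal (D (Suc j) x * (x (Suc j) - bm_Upsilon \<alpha> \<beta> j (x j))\<^sup>2)) \<in> borel_measurable (PiM (insert (Suc j) {..j}) (\<lambda>_. lborel))"
      by measurable
    show "(\<integral>\<^sup>+x. (\<integral>\<^sup>+u. ennreal (D (Suc j) (x(Suc j := u)) * ((x(Suc j := u)) (Suc j) - bm_Upsilon \<alpha> \<beta> j ((x(Suc j := u)) j))\<^sup>2) \<partial>lborel)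
       \<partial>PiM {..j} (\<lambda>_. lborel)) = 
      (\<integral>\<^sup>+x. (\<integral>\<^sup>+u. ennreal (D j x) * ennreal (bm_trans_density N \<alpha> \<beta> j (x j) u * (u - bm_Upsilon \<alpha> \<beta> j (x j))\<^sup>2) \<partial>lborel)
       \<partial>PiM {..j} (\<lambda>_. lborel))"
      by (intro nn_integral_cong)
         (auto simp: ennreal_mult'[symmetric] D_nonneg bm_trans_density_nonneg pos, simp add: D_def)
  qed auto
  also have "\<dots> = (\<integral>\<^sup>+x. ennreal (D j x) * (\<integral>\<^sup>+u. ennreal (bm_trans_density N \<alpha> \<beta> j (x j) u * (u - bm_Upsilon \<alpha> \<beta> j (x j))\<^sup>2) \<partial>lborel)
       \<partial>PiM {..j} (\<lambda>_. lborel))"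
    by (intro nn_integral_cong nn_integral_cmult measurable_compose[OF _ measurable_ennreal]
          borel_measurable_times borel_measurable_bm_trans_density pos) measurable
  also have "\<dots> \<le> (\<integral>\<^sup>+x. ennreal (D j x) * ?C \<partial>PiM {..j} (\<lambda>_. lborel))"
    unfolding bm_trans_density_def
    by (intro nn_integral_mono mult_left_mono beta_binomial_mixture_second_moment pos N bm_Upsilon_range) auto
  also have "\<dots> = ?C"
    by (subst nn_integral_multc) (auto simp: D_int)
  finally show ?thesis .
qed

text \<open>The joint density of the coordinates up to j contains a factor that vanishes as soon as
  coordinate j leaves the open unit interval.\<close>

lemma beta_markov_chain_AE_range:
  assumes chain: "beta_markov_chain M N \<alpha> \<beta> v" and pos: "\<And>j. 0 < \<alpha> j" "\<And>j. 0 < \<beta> j"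
  shows "AE \<omega> in M. \<forall>j. 0 < v j \<omega> \<and> v j \<omega> < 1"
proof -
  have [measurable]: "v i \<in> borel_measurable M" for i
    using chain by (simp add: beta_markov_chain_def)
  have "AE \<omega> in M. 0 < v j \<omega> \<and> v j \<omega> < 1" for j
  proof -
    let ?D = "\<lambda>x. beta_density (\<alpha> 0) (\<beta> 0) (x 0) * (\<Prod>i<j. bm_trans_density N \<alpha> \<beta> i (x i) (x (Suc i)))"
    have [measurable]: "?D \<in> borel_measurable (PiM {..j} (\<lambda>_. lborel))"
      by (measurable; (intro borel_measurable_bm_trans_density pos)?; measurable)
    have supp: "0 < x j \<and> x j < 1" if "?D x \<noteq> 0" for x
    proof (cases j)
      case 0
      then show ?thesis using that by (auto simp: beta_density_def split: if_splits)
    next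
      case (Suc i)
      then have "bm_trans_density N \<alpha> \<beta> i (x i) (x (Suc i)) \<noteq> 0" using that by auto
      then show ?thesis using bm_trans_density_support Suc by blast
    qed
    have "AE x in density (PiM {..j} (\<lambda>_. lborel)) (\<lambda>x. ennreal (?D x)). 0 < x j \<and> x j < 1"
      by (subst AE_density) (measurable, intro AE_I2 impI supp notI, simp)
    also have "density (PiM {..j} (\<lambda>_. lborel)) (\<lambda>x. ennreal (?D x)) = 
       distr M (PiM {..j} (\<lambda>_. lborel)) (\<lambda>\<omega>. \<lambda>i\<in>{..j}. v i \<omega>)"
      using chain by (simp add: beta_markov_chain_def)
    finally have "AE \<omega> in M. 0 < (\<lambda>i\<in>{..j}. v i \<omega>) j \<and> (\<lambda>i\<in>{..j}. v i \<omega>) j < 1"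
      by (rule AE_distrD[rotated]) (rule measurable_restrict, simp)
    then show ?thesis by simp
  qed
  then show ?thesis by (simp add: AE_all_countable)
qed

text \<open>For N = 0 the mixture has the single term z = 0 with weight 1, so the transition forgets
  the previous state and the joint density of each initial segment factorises into Beta
  densities.\<close>

lemma beta_markov_chain_0:
  assumes chain: "beta_markov_chain M 0 \<alpha> \<beta> v" and pos: "\<And>j. 0 < \<alpha> j" "\<And>j. 0 < \<beta> j"
    and M: "prob_space M"
  shows "prob_space.indep_vars M (\<lambda>_. lborel) v UNIV" 
    and "distr M lborel (v j) = beta_measure (\<alpha> j) (\<beta> j)"
proof -
  interpret prob_space M by fact
  have [measurable]: "v i \<in> borel_measurable M" for i
    using chain by (simp add: beta_markov_chain_def)
  have prob: "prob_space (beta_measure (\<alpha> i) (\<beta> i))" for i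
    using real_distribution_beta_measure[OF pos] by (simp add: real_distribution_def)
  interpret B: product_sigma_finite "\<lambda>i. beta_measure (\<alpha> i) (\<beta> i)"
    by (simp add: product_sigma_finite_def prob_space_imp_sigma_finite[OF prob])
  interpret L: product_sigma_finite "\<lambda>_::nat. lborel :: real measure"
    by standard
  have joint: "distr M (PiM {..k} (\<lambda>_. lborel)) (\<lambda>\<omega>. \<lambda>i\<in>{..k}. v i \<omega>) = PiM {..k} (\<lambda>i. beta_measure (\<alpha> i) (\<beta> i))" for k
  proof -
    have "beta_density (\<alpha> 0) (\<beta> 0) (x 0) * (\<Prod>i<k. bm_trans_density 0 \<alpha> \<beta> i (x i) (x (Suc i)))
        = (\<Prod>i\<le>k. beta_density (\<alpha> i) (\<beta> i) (x i))" for x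
      by (simp add: bm_trans_density_def prod.atMost_shift)
    then have "distr M (PiM {..k} (\<lambda>_. lborel)) (\<lambda>\<omega>. \<lambda>i\<in>{..k}. v i \<omega>) =
        density (PiM {..k} (\<lambda>_. lborel)) (\<lambda>x. \<Prod>i\<le>k. ennreal (beta_density (\<alpha> i) (\<beta> i) (x i)))"
      using chain pos by (simp add: beta_markov_chain_def prod_ennreal beta_density_nonneg)
    also have "\<dots> = PiM {..k} (\<lambda>i. beta_measure (\<alpha> i) (\<beta> i))"
    proof (rule B.PiM_eqI)
      fix A assume A: "\<And>i. i \<in> {..k} \<Longrightarrow> A i \<in> sets (beta_measure (\<alpha> i) (\<beta> i))"
      then have [measurable]: "Pi\<^sub>E {..k} A \<in> sets (PiM {..k} (\<lambda>_. lborel))"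
        by (intro sets_PiM_I_finite) auto
      have "emeasure (density (PiM {..k} (\<lambda>_. lborel)) (\<lambda>x. \<Prod>i\<le>k. ennreal (beta_density (\<alpha> i) (\<beta> i) (x i)))) (Pi\<^sub>E {..k} A)
         = (\<integral>\<^sup>+x. (\<Prod>i\<le>k. ennreal (beta_density (\<alpha> i) (\<beta> i) (x i))) * indicator (Pi\<^sub>E {..k} A) x \<partial>PiM {..k} (\<lambda>_. lborel))"
        by (rule emeasure_density) measurable
      also have "\<dots> = (\<integral>\<^sup>+x. (\<Prod>i\<le>k. ennreal (beta_density (\<alpha> i) (\<beta> i) (x i)) * indicator (A i) (x i)) \<partial>PiM {..k} (\<lambda>_. lborel))"
        by (intro nn_integral_cong) (auto simp: prod.distrib indicator_def space_PiM PiE_iff)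
      also have "\<dots> = (\<Prod>i\<le>k. \<integral>\<^sup>+u. ennreal (beta_density (\<alpha> i) (\<beta> i) u) * indicator (A i) u \<partial>lborel)"
        using A by (intro L.product_nn_integral_prod[where f = "\<lambda>i u. ennreal (beta_density (\<alpha> i) (\<beta> i) u) * indicator (A i) u"]) auto
      also have "\<dots> = (\<Prod>i\<le>k. emeasure (beta_measure (\<alpha> i) (\<beta> i)) (A i))"
        using A by (intro prod.cong) (auto simp: beta_measure_def emeasure_density)
      finally show "emeasure (density (PiM {..k} (\<lambda>_. lborel)) (\<lambda>x. \<Prod>i\<le>k. ennreal (beta_density (\<alpha> i) (\<beta> i) (x i)))) (Pi\<^sub>E {..k} A)
         = (\<Prod>i\<le>k. emeasure (beta_measure (\<alpha> i) (\<beta> i)) (A i))" .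
    qed (auto intro!: sets_PiM_cong)
    finally show ?thesis .
  qed
  have marginal: "distr M lborel (v j) = beta_measure (\<alpha> j) (\<beta> j)" for j
  proof -
    have "distr M lborel (v j) = distr (distr M (PiM {..j} (\<lambda>_. lborel)) (\<lambda>\<omega>. \<lambda>i\<in>{..j}. v i \<omega>)) lborel (\<lambda>x. x j)"
      by (subst distr_distr) (auto simp: comp_def intro!: measurable_restrict)
    also have "\<dots> = distr (PiM {..j} (\<lambda>i. beta_measure (\<alpha> i) (\<beta> i))) (beta_measure (\<alpha> j) (\<beta> j)) (\<lambda>x. x j)"
      unfolding joint by (rule distr_cong) auto
    also have "\<dots> = beta_measure (\<alpha> j) (\<beta> j)"
      by (rule distr_PiM_component) (auto intro: prob)
    finally show ?thesis .
  qed
  then show "distr M lborel (v j) = beta_measure (\<alpha> j) (\<beta> j)" .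
  have "indep_vars (\<lambda>_. lborel) v {..k}" for k
    using marginal by (subst indep_vars_iff_distr_eq_PiM) (simp_all add: joint marginal)
  then have fin: "indep_sets (\<lambda>i. {v i -` A \<inter> space M |A. A \<in> sets lborel}) {..k}" for k
    by (simp add: indep_vars_def2)
  \<comment> \<open>Independence is a condition on finite subfamilies, and each of these lies in an
    initial segment.\<close>
  have "indep_sets (\<lambda>i. {v i -` A \<inter> space M |A. A \<in> sets lborel}) UNIV"
  proof (subst indep_sets_finite_index_sets, intro allI impI)
    fix J :: "nat set" assume "finite J"
    then obtain k where "J \<subseteq> {..k}" by (meson finite_nat_iff_bounded_le)
    then show "indep_sets (\<lambda>i. {v i -` A \<inter> space M |A. A \<in> sets lborel}) J"
      using fin by (rule indep_sets_mono_index)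
  qed
  then show "indep_vars (\<lambda>_. lborel) v UNIV"
    by (simp add: indep_vars_def2)
qed

lemma beta_markov_chain_distr_0:
  assumes chain: "beta_markov_chain M N \<alpha> \<beta> v" and pos: "\<And>j. 0 < \<alpha> j" "\<And>j. 0 < \<beta> j"
  shows "distr M lborel (v 0) = beta_measure (\<alpha> 0) (\<beta> 0)"
proof (rule measure_eqI)
  interpret L: product_sigma_finite "\<lambda>_::nat. lborel :: real measure"
    by standard
  have [measurable]: "v i \<in> borel_measurable M" for i
    using chain by (simp add: beta_markov_chain_def)
  fix A assume "A \<in> sets (distr M lborel (v 0))"
  then have [measurable]: "A \<in> sets borel" by simp
  have "emeasure (distr M lborel (v 0)) A = (\<integral>\<^sup>+\<omega>. indicator A (v 0 \<omega>) \<partial>M)"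
    by (subst nn_integral_indicator[symmetric], simp, subst nn_integral_distr) auto
  also have "\<dots> = (\<integral>\<^sup>+x. indicator A (x 0) \<partial>distr M (PiM {..0} (\<lambda>_. lborel)) (\<lambda>\<omega>. \<lambda>i\<in>{..0}. v i \<omega>))"
    by (subst nn_integral_distr) auto
  also have "\<dots> = (\<integral>\<^sup>+x. ennreal (beta_density (\<alpha> 0) (\<beta> 0) (x 0)) * indicator A (x 0) \<partial>PiM {0::nat} (\<lambda>_. lborel))"
    using chain[unfolded beta_markov_chain_def, THEN conjunct2, THEN spec, of 0]
    by (simp add: nn_integral_density)
  also have "\<dots> = (\<integral>\<^sup>+u. ennreal (beta_density (\<alpha> 0) (\<beta> 0) u) * indicator A u \<partial>lborel)"
    by (rule L.product_nn_integral_singleton[where i = 0]) simp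
  also have "\<dots> = emeasure (beta_measure (\<alpha> 0) (\<beta> 0)) A"
    by (simp add: beta_measure_def emeasure_density)
  finally show "emeasure (distr M lborel (v 0)) A = emeasure (beta_measure (\<alpha> 0) (\<beta> 0)) A" .
qed simp

subsection \<open>Convergence in probability along varying probability spaces\<close>

text \<open>Both sequences vary with n and no limit variable occurs, because the probability space
  itself changes with n.\<close>

definition conv_prob :: "(nat \<Rightarrow> 'a measure) \<Rightarrow> (nat \<Rightarrow> 'a \<Rightarrow> 'b::metric_space) \<Rightarrow> (nat \<Rightarrow> 'a \<Rightarrow> 'b) \<Rightarrow> bool" where
  "conv_prob M X Y \<longleftrightarrow> 
    (\<forall>e>0. (\<lambda>n. measure (M n) {\<omega> \<in> space (M n). e \<le> dist (X n \<omega>) (Y n \<omega>)}) \<longlonglongrightarrow> 0)"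

text \<open>Chebyshev's inequality, with the second moment as an extended integral so that
  integrability need not be settled beforehand.\<close>

lemma conv_probI_square:
  fixes X Y :: "nat \<Rightarrow> 'a \<Rightarrow> real"
  assumes prob: "\<And>n. prob_space (M n)"
    and [measurable]: "\<And>n. X n \<in> borel_measurable (M n)" "\<And>n. Y n \<in> borel_measurable (M n)"
    and le: "\<forall>\<^sub>F n in sequentially. (\<integral>\<^sup>+\<omega>. ennreal ((X n \<omega> - Y n \<omega>)\<^sup>2) \<partial>M n) \<le> ennreal (c n)"
    and c: "c \<longlonglongrightarrow> 0"
  shows "conv_prob M X Y"
  unfolding conv_prob_def
proof (intro allI impI)
  fix e :: real assume e: "0 < e"
  \<comment> \<open>\<open>c n\<close> may be negative, in which case \<open>ennreal\<close> sends
    it to 0; its positive part is the real number that matches.\<close>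
  have "(\<lambda>n. max 0 (c n) / e\<^sup>2) \<longlonglongrightarrow> max 0 0 / e\<^sup>2"
    using e by (intro tendsto_intros c) auto
  then have lim: "(\<lambda>n. max 0 (c n) / e\<^sup>2) \<longlonglongrightarrow> 0" by simp
  show "(\<lambda>n. measure (M n) {\<omega> \<in> space (M n). e \<le> dist (X n \<omega>) (Y n \<omega>)}) \<longlonglongrightarrow> 0"
  proof (rule tendsto_sandwich[OF _ _ tendsto_const lim])
    show "\<forall>\<^sub>F n in sequentially. measure (M n) {\<omega> \<in> space (M n). e \<le> dist (X n \<omega>) (Y n \<omega>)} \<le> max 0 (c n) / e\<^sup>2"
      using le
    proof eventually_elim
      case (elim n)
      interpret prob_space "M n" by (rule prob)
      let ?A = "{\<omega> \<in> space (M n). e \<le> dist (X n \<omega>) (Y n \<omega>)}"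
      have "emeasure (M n) ?A = (\<integral>\<^sup>+\<omega>. indicator ?A \<omega> \<partial>M n)"
        by (rule nn_integral_indicator[symmetric]) measurable
      also have "\<dots> \<le> (\<integral>\<^sup>+\<omega>. ennreal (1 / e\<^sup>2) * ennreal ((X n \<omega> - Y n \<omega>)\<^sup>2) \<partial>M n)"
      proof (intro nn_integral_mono)
        fix \<omega>
        have "e\<^sup>2 \<le> (X n \<omega> - Y n \<omega>)\<^sup>2" if "\<omega> \<in> ?A"
          using that e power_mono[of e "\<bar>X n \<omega> - Y n \<omega>\<bar>" 2] by (simp add: dist_real_def)
        then show "indicator ?A \<omega> \<le> ennreal (1 / e\<^sup>2) * ennreal ((X n \<omega> - Y n \<omega>)\<^sup>2)"
          using e by (auto simp: indicator_def ennreal_mult[symmetric] simp flip: ennreal_1 intro!: ennreal_leI)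
      qed
      also have "\<dots> = ennreal (1 / e\<^sup>2) * (\<integral>\<^sup>+\<omega>. ennreal ((X n \<omega> - Y n \<omega>)\<^sup>2) \<partial>M n)"
        by (rule nn_integral_cmult) measurable
      also have "\<dots> \<le> ennreal (1 / e\<^sup>2) * ennreal (max 0 (c n))"
        using elim by (intro mult_left_mono order_trans[OF elim] ennreal_leI) auto
      also have "\<dots> = ennreal (max 0 (c n) / e\<^sup>2)"
        by (subst ennreal_mult[symmetric]) (simp_all del: ennreal_max_0')
      finally show ?case
        by (simp add: emeasure_eq_measure)
    qed
  qed (simp add: measure_nonneg)
qed

lemma conv_probI_uniform:
  assumes "\<And>n \<omega>. dist (X n \<omega>) (Y n \<omega>) \<le> c n" "c \<longlonglongrightarrow> 0"
  shows "conv_prob M X Y"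
  unfolding conv_prob_def
proof (intro allI impI)
  fix e :: real assume "0 < e"
  then have "\<forall>\<^sub>F n in sequentially. c n < e"
    using assms(2) by (simp add: order_tendsto_iff)
  then have "\<forall>\<^sub>F n in sequentially. measure (M n) {\<omega> \<in> space (M n). e \<le> dist (X n \<omega>) (Y n \<omega>)} = 0"
  proof eventually_elim
    case (elim n)
    then have "\<not> e \<le> dist (X n \<omega>) (Y n \<omega>)" for \<omega>
      using assms(1)[of n \<omega>] by linarith
    then show ?case by simp
  qed
  then show "(\<lambda>n. measure (M n) {\<omega> \<in> space (M n). e \<le> dist (X n \<omega>) (Y n \<omega>)}) \<longlonglongrightarrow> 0"
    by (rule tendsto_eventually)
qed

lemma conv_prob_trans:
  fixes X Y Z :: "nat \<Rightarrow> 'a \<Rightarrow> 'b::{metric_space, second_countable_topology}"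
  assumes prob: "\<And>n. prob_space (M n)"
    and [measurable]: "\<And>n. X n \<in> borel_measurable (M n)" "\<And>n. Y n \<in> borel_measurable (M n)"
      "\<And>n. Z n \<in> borel_measurable (M n)"
    and XY: "conv_prob M X Y" and YZ: "conv_prob M Y Z"
  shows "conv_prob M X Z"
  unfolding conv_prob_def
proof (intro allI impI)
  fix e :: real assume "0 < e"
  then have e: "0 < e / 2" by simp
  have lim: "(\<lambda>n. measure (M n) {\<omega> \<in> space (M n). e / 2 \<le> dist (X n \<omega>) (Y n \<omega>)}
       + measure (M n) {\<omega> \<in> space (M n). e / 2 \<le> dist (Y n \<omega>) (Z n \<omega>)}) \<longlonglongrightarrow> 0 + 0"
    using XY YZ e unfolding conv_prob_def by (intro tendsto_add) blast+
  show "(\<lambda>n. measure (M n) {\<omega> \<in> space (M n). e \<le> dist (X n \<omega>) (Z n \<omega>)}) \<longlonglongrightarrow> 0"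
  proof (rule tendsto_sandwich[OF _ _ tendsto_const lim[unfolded add_0_left]])
    show "\<forall>\<^sub>F n in sequentially. measure (M n) {\<omega> \<in> space (M n). e \<le> dist (X n \<omega>) (Z n \<omega>)} \<le> 
       measure (M n) {\<omega> \<in> space (M n). e / 2 \<le> dist (X n \<omega>) (Y n \<omega>)}
       + measure (M n) {\<omega> \<in> space (M n). e / 2 \<le> dist (Y n \<omega>) (Z n \<omega>)}"
    proof (rule always_eventually, rule allI)
      fix n
      interpret prob_space "M n" by (rule prob)
      have "{\<omega> \<in> space (M n). e \<le> dist (X n \<omega>) (Z n \<omega>)} \<subseteq> 
        {\<omega> \<in> space (M n). e / 2 \<le> dist (X n \<omega>) (Y n \<omega>)} \<union> {\<omega> \<in> space (M n). e / 2 \<le> dist (Y n \<omega>) (Z n \<omega>)}"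
      proof safe
        fix \<omega> assume "e \<le> dist (X n \<omega>) (Z n \<omega>)" "\<not> e / 2 \<le> dist (Y n \<omega>) (Z n \<omega>)"
        then show "e / 2 \<le> dist (X n \<omega>) (Y n \<omega>)"
          using dist_triangle[of "X n \<omega>" "Z n \<omega>" "Y n \<omega>"] by linarith
      qed
      then have "measure (M n) {\<omega> \<in> space (M n). e \<le> dist (X n \<omega>) (Z n \<omega>)} \<le> measure (M n) ({\<omega> \<in> space (M n). e / 2 \<le> dist (X n \<omega>) (Y n \<omega>)} \<union> {\<omega> \<in> space (M n). e / 2 \<le> dist (Y n \<omega>) (Z n \<omega>)})"
        by (rule finite_measure_mono) measurable
      also have "\<dots> \<le> measure (M n) {\<omega> \<in> space (M n). e / 2 \<le> dist (X n \<omega>) (Y n \<omega>)}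
       + measure (M n) {\<omega> \<in> space (M n). e / 2 \<le> dist (Y n \<omega>) (Z n \<omega>)}"
        by (rule measure_Un_le) measurable
      finally show "measure (M n) {\<omega> \<in> space (M n). e \<le> dist (X n \<omega>) (Z n \<omega>)} \<le> 
       measure (M n) {\<omega> \<in> space (M n). e / 2 \<le> dist (X n \<omega>) (Y n \<omega>)}
       + measure (M n) {\<omega> \<in> space (M n). e / 2 \<le> dist (Y n \<omega>) (Z n \<omega>)}" .
    qed
  qed (simp add: measure_nonneg)
qed

text \<open>One fixed \<open>g\<close> is uniformly continuous on the compact set, so a small
  distance of the arguments forces a small distance of the images. The images are separate
  variables, equal to \<open>g\<close> of the arguments almost surely, because identities such as
  recovering v from F(v) hold only while v stays in the unit interval.\<close>

lemma conv_prob_continuous: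
  fixes X Y :: "nat \<Rightarrow> 'a \<Rightarrow> 'b::{metric_space, second_countable_topology}"
    and X' Y' :: "nat \<Rightarrow> 'a \<Rightarrow> 'c::{metric_space, second_countable_topology}"
  assumes prob: "\<And>n. prob_space (M n)"
    and [measurable]: "\<And>n. X n \<in> borel_measurable (M n)" "\<And>n. Y n \<in> borel_measurable (M n)"
    and K: "compact K" and g: "continuous_on K g"
    and X: "\<And>n. AE \<omega> in M n. X n \<omega> \<in> K \<and> X' n \<omega> = g (X n \<omega>)"
    and Y: "\<And>n. AE \<omega> in M n. Y n \<omega> \<in> K \<and> Y' n \<omega> = g (Y n \<omega>)"
    and XY: "conv_prob M X Y"
  shows "conv_prob M X' Y'"
  unfolding conv_prob_def
proof (intro allI impI)
  fix e :: real assume "0 < e"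
  then obtain d where d: "0 < d" "\<And>x y. x \<in> K \<Longrightarrow> y \<in> K \<Longrightarrow> dist y x < d \<Longrightarrow> dist (g y) (g x) < e"
    using compact_uniformly_continuous[OF g K] unfolding uniformly_continuous_on_def by metis
  have lim: "(\<lambda>n. measure (M n) {\<omega> \<in> space (M n). d \<le> dist (X n \<omega>) (Y n \<omega>)}) \<longlonglongrightarrow> 0"
    using XY d(1) by (simp add: conv_prob_def)
  show "(\<lambda>n. measure (M n) {\<omega> \<in> space (M n). e \<le> dist (X' n \<omega>) (Y' n \<omega>)}) \<longlonglongrightarrow> 0"
  proof (rule tendsto_sandwich[OF _ _ tendsto_const lim])
    show "\<forall>\<^sub>F n in sequentially. measure (M n) {\<omega> \<in> space (M n). e \<le> dist (X' n \<omega>) (Y' n \<omega>)} \<le> 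
      measure (M n) {\<omega> \<in> space (M n). d \<le> dist (X n \<omega>) (Y n \<omega>)}"
    proof (rule always_eventually, rule allI)
      fix n
      interpret prob_space "M n" by (rule prob)
      have "AE \<omega> in M n. \<omega> \<in> {\<omega> \<in> space (M n). e \<le> dist (X' n \<omega>) (Y' n \<omega>)} \<longrightarrow> 
        \<omega> \<in> {\<omega> \<in> space (M n). d \<le> dist (X n \<omega>) (Y n \<omega>)}"
        using X[of n] Y[of n]
      proof eventually_elim
        case (elim \<omega>)
        then show ?case
          using d(2)[of "Y n \<omega>" "X n \<omega>"] by (auto simp: not_le[symmetric])
      qed
      then show "measure (M n) {\<omega> \<in> space (M n). e \<le> dist (X' n \<omega>) (Y' n \<omega>)} \<le> 
        measure (M n) {\<omega> \<in> space (M n). d \<le> dist (X n \<omega>) (Y n \<omega>)}"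
        by (rule finite_measure_mono_AE) measurable
    qed
  qed (simp add: measure_nonneg)
qed

lemma conv_prob_expectation:
  fixes X Y :: "nat \<Rightarrow> 'a \<Rightarrow> real"
  assumes prob: "\<And>n. prob_space (M n)"
    and [measurable]: "\<And>n. X n \<in> borel_measurable (M n)" "\<And>n. Y n \<in> borel_measurable (M n)"
    and XY: "conv_prob M X Y"
    and bound: "\<And>n \<omega>. \<bar>X n \<omega>\<bar> \<le> B" "\<And>n \<omega>. \<bar>Y n \<omega>\<bar> \<le> B"
  shows "(\<lambda>n. (\<integral>\<omega>. X n \<omega> \<partial>M n) - (\<integral>\<omega>. Y n \<omega> \<partial>M n)) \<longlonglongrightarrow> 0"
proof (rule LIMSEQ_I)
  fix r :: real assume r: "0 < r"
  have B: "0 \<le> B" using bound(1)[of 0 undefined] by linarith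
  \<comment> \<open>Chosen so that e + 2 B e, the bound obtained by splitting at distance e, is
    strictly below r.\<close>
  define e where "e = r / (2 * B + 2)"
  have e: "0 < e" using r B by (simp add: e_def)
  let ?A = "\<lambda>n. {\<omega> \<in> space (M n). e \<le> dist (X n \<omega>) (Y n \<omega>)}"
  have "\<forall>\<^sub>F n in sequentially. measure (M n) (?A n) < e"
    using XY e unfolding conv_prob_def by (auto intro: order_tendstoD(2))
  then obtain n0 where n0: "\<And>n. n0 \<le> n \<Longrightarrow> measure (M n) (?A n) < e"
    by (auto simp: eventually_sequentially)
  have "norm ((\<integral>\<omega>. X n \<omega> \<partial>M n) - (\<integral>\<omega>. Y n \<omega> \<partial>M n) - 0) < r" if "n0 \<le> n" for n
  proof -
    interpret prob_space "M n" by (rule prob)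
    have int: "integrable (M n) (X n)" "integrable (M n) (Y n)"
      using bound by (auto intro!: integrable_const_bound[where B = B])
    have A: "?A n \<in> sets (M n)" by measurable
    have "\<bar>(\<integral>\<omega>. X n \<omega> \<partial>M n) - (\<integral>\<omega>. Y n \<omega> \<partial>M n)\<bar> = \<bar>\<integral>\<omega>. X n \<omega> - Y n \<omega> \<partial>M n\<bar>"
      using int by simp
    also have "\<dots> \<le> (\<integral>\<omega>. \<bar>X n \<omega> - Y n \<omega>\<bar> \<partial>M n)"
      by (rule integral_abs_bound)
    also have "\<dots> \<le> (\<integral>\<omega>. e + 2 * B * indicator (?A n) \<omega> \<partial>M n)"
    proof (rule integral_mono)
      fix \<omega> assume "\<omega> \<in> space (M n)"
      then show "\<bar>X n \<omega> - Y n \<omega>\<bar> \<le> e + 2 * B * indicator (?A n) \<omega>"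
        using bound(1)[of n \<omega>] bound(2)[of n \<omega>] e by (auto simp: indicator_def dist_real_def)
    qed (use int A in \<open>auto intro!: integrable_real_indicator simp: emeasure_eq_measure\<close>)
    also have "\<dots> = e + 2 * B * measure (M n) (?A n)"
      using A by (subst Bochner_Integration.integral_add)
        (auto simp: prob_space emeasure_eq_measure intro!: integrable_real_indicator)
    also have "\<dots> \<le> e + 2 * B * e"
      using n0[OF that] B by (intro add_left_mono mult_left_mono) auto
    also have "\<dots> < (2 * B + 2) * e" using e by (simp add: algebra_simps)
    also have "\<dots> = r" using B by (simp add: e_def)
    finally show ?thesis by simp
  qed
  then show "\<exists>no. \<forall>n\<ge>no. norm ((\<integral>\<omega>. X n \<omega> \<partial>M n) - (\<integral>\<omega>. Y n \<omega> \<partial>M n) - 0) < r" by blast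
qed

text \<open>The metric on sequences is controlled by finitely many coordinates up to an error that
  is geometrically small in their number; a finite union bound handles these coordinates.\<close>

lemma conv_prob_sequence:
  fixes X Y :: "nat \<Rightarrow> 'a \<Rightarrow> nat \<Rightarrow> 'b::{metric_space, second_countable_topology}"
  assumes prob: "\<And>n. prob_space (M n)"
    and [measurable]: "\<And>n j. (\<lambda>\<omega>. X n \<omega> j) \<in> borel_measurable (M n)" "\<And>n j. (\<lambda>\<omega>. Y n \<omega> j) \<in> borel_measurable (M n)"
    and XY: "\<And>j. conv_prob M (\<lambda>n \<omega>. X n \<omega> j) (\<lambda>n \<omega>. Y n \<omega> j)"
  shows "conv_prob M X Y"
  unfolding conv_prob_def
proof (intro allI impI)
  fix e :: real assume e: "0 < e"
  then obtain k where k: "(1/2) ^ k < e / 2"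
    using real_arch_pow_inv[of "e / 2" "1 / 2"] by auto
  \<comment> \<open>The metric is at most twice the largest coordinate distance plus (1/2)^k, so e/4
    per coordinate contributes e/2 and the choice of k leaves less than e/2 for the rest.\<close>
  let ?A = "\<lambda>n i. {\<omega> \<in> space (M n). e / 4 \<le> dist (X n \<omega> (from_nat i)) (Y n \<omega> (from_nat i))}"
  have lim: "(\<lambda>n. \<Sum>i\<le>k. measure (M n) (?A n i)) \<longlonglongrightarrow> (\<Sum>i\<le>k. 0)"
    using XY[unfolded conv_prob_def, rule_format, of "e / 4"] e by (intro tendsto_sum) simp
  show "(\<lambda>n. measure (M n) {\<omega> \<in> space (M n). e \<le> dist (X n \<omega>) (Y n \<omega>)}) \<longlonglongrightarrow> 0"
  proof (rule tendsto_sandwich[OF _ _ tendsto_const lim[unfolded sum.neutral_const]])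
    show "\<forall>\<^sub>F n in sequentially. measure (M n) {\<omega> \<in> space (M n). e \<le> dist (X n \<omega>) (Y n \<omega>)} \<le> (\<Sum>i\<le>k. measure (M n) (?A n i))"
    proof (rule always_eventually, rule allI)
      fix n
      interpret prob_space "M n" by (rule prob)
      have "{\<omega> \<in> space (M n). e \<le> dist (X n \<omega>) (Y n \<omega>)} \<subseteq> (\<Union>i\<le>k. ?A n i)"
      proof
        fix \<omega> assume \<omega>: "\<omega> \<in> {\<omega> \<in> space (M n). e \<le> dist (X n \<omega>) (Y n \<omega>)}"
        show "\<omega> \<in> (\<Union>i\<le>k. ?A n i)"
        proof (rule ccontr)
          assume "\<not> ?thesis"
          then have *: "dist (X n \<omega> (from_nat i)) (Y n \<omega> (from_nat i)) < e / 4" if "i \<le> k" for i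
            using that \<omega> by (auto simp: not_le)
          have "Max {dist (X n \<omega> (from_nat i)) (Y n \<omega> (from_nat i)) |i. i \<le> k} < e / 4"
            using * by (subst Max_less_iff) (auto simp: setcompr_eq_image atMost_def[symmetric])
          then show False
            using dist_fun_le_dist_first_terms[of "X n \<omega>" "Y n \<omega>" k] k \<omega> by auto
        qed
      qed
      then have "measure (M n) {\<omega> \<in> space (M n). e \<le> dist (X n \<omega>) (Y n \<omega>)} \<le> measure (M n) (\<Union>i\<le>k. ?A n i)"
        by (rule finite_measure_mono) measurable
      also have "\<dots> \<le> (\<Sum>i\<le>k. measure (M n) (?A n i))"
        by (rule finite_measure_subadditive_finite) (auto, measurable)
      finally show "measure (M n) {\<omega> \<in> space (M n). e \<le> dist (X n \<omega>) (Y n \<omega>)} \<le> (\<Sum>i\<le>k. measure (M n) (?A n i))" .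
    qed
  qed (simp add: measure_nonneg)
qed

lemma compact_unit_sequences: "compact {x :: nat \<Rightarrow> real. \<forall>i. 0 \<le> x i \<and> x i \<le> 1}"
proof -
  have "compactin (product_topology (\<lambda>_::nat. euclidean :: real topology) UNIV) (PiE UNIV (\<lambda>_. {0..1}))"
    by (simp add: compactin_PiE)
  then have "compact (PiE UNIV (\<lambda>_::nat. {0..1::real}))"
    by (simp add: euclidean_product_topology)
  also have "PiE UNIV (\<lambda>_::nat. {0..1::real}) = {x. \<forall>i. 0 \<le> x i \<and> x i \<le> 1}"
    by (auto simp: PiE_iff)
  finally show ?thesis .
qed

subsection \<open>Stick-breaking weights\<close>

lemma continuous_on_sb_weights: "continuous_on UNIV sb_weights"
  unfolding sb_weights_def[abs_def]
  by (intro continuous_intros continuous_on_product_coordinates)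

lemma sum_sb_weights: "(\<Sum>j<k. sb_weights v j) = 1 - (\<Prod>i<k. 1 - v i)"
  by (induction k) (simp_all add: sb_weights_def algebra_simps)

lemma sb_weights_nonneg: "(\<And>i. 0 \<le> v i) \<Longrightarrow> (\<And>i. v i \<le> 1) \<Longrightarrow> 0 \<le> sb_weights v j"
  unfolding sb_weights_def by (intro mult_nonneg_nonneg prod_nonneg) auto

text \<open>The mass left after k sticks is the product of the 1 - v i, which is at most exp of
  minus the partial sum of the v i.\<close>

lemma sb_weights_sums_1:
  assumes v: "\<And>i. 0 \<le> v i" "\<And>i. v i \<le> 1" and inf: "(\<Sum>j. ennreal (v j)) = \<infinity>"
  shows "sb_weights v sums 1"
proof -
  have "(\<lambda>k. \<Sum>i<k. ennreal (v i)) \<longlonglongrightarrow> \<infinity>"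
    using summable_LIMSEQ[of "\<lambda>j. ennreal (v j)"] inf by simp
  then have "(\<lambda>k. ennreal (\<Sum>i<k. v i)) \<longlonglongrightarrow> \<infinity>"
    using v by (simp add: sum_ennreal)
  then have "filterlim (\<lambda>k. \<Sum>i<k. v i) at_top sequentially"
    by (simp add: ennreal_tendsto_top_eq_at_top)
  then have lim: "(\<lambda>k. exp (- (\<Sum>i<k. v i))) \<longlonglongrightarrow> 0"
    by (intro filterlim_compose[OF exp_at_bot] filterlim_compose[OF filterlim_uminus_at_bot_at_top])
  have "(\<lambda>k. \<Prod>i<k. 1 - v i) \<longlonglongrightarrow> 0"
  proof (rule tendsto_sandwich[OF _ _ tendsto_const lim])
    have "(\<Prod>i<k. 1 - v i) \<le> exp (- (\<Sum>i<k. v i))" for k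
    proof -
      have "(\<Prod>i<k. 1 - v i) \<le> (\<Prod>i<k. exp (- v i))"
        using v exp_ge_add_one_self[of "- v i" for i] by (intro prod_mono) auto
      then show ?thesis by (simp add: exp_sum sum_negf[symmetric])
    qed
    then show "\<forall>\<^sub>F k in sequentially. (\<Prod>i<k. 1 - v i) \<le> exp (- (\<Sum>i<k. v i))" by simp
    show "\<forall>\<^sub>F k in sequentially. 0 \<le> (\<Prod>i<k. 1 - v i)"
      using v by (intro always_eventually allI prod_nonneg) auto
  qed
  then have "(\<lambda>k. 1 - (\<Prod>i<k. 1 - v i)) \<longlonglongrightarrow> 1 - 0" by (intro tendsto_intros)
  then show ?thesis by (simp add: sums_def sum_sb_weights)
qed

text \<open>Both weights share the product over i < j; what remains is v (Suc j) (1 - v j) <= v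
  j.\<close>

lemma sb_weights_decreasing:
  assumes "\<And>i. 0 \<le> v i" "\<And>i. v i \<le> 1" "v (Suc j) \<le> v j"
  shows "sb_weights v (Suc j) \<le> sb_weights v j"
proof -
  have "v (Suc j) * (1 - v j) \<le> v j * 1"
    using assms by (intro mult_mono) auto
  then have "v (Suc j) * (1 - v j) * (\<Prod>i<j. 1 - v i) \<le> v j * (\<Prod>i<j. 1 - v i)"
    using assms by (intro mult_right_mono prod_nonneg) auto
  then show ?thesis by (simp add: sb_weights_def mult_ac)
qed

subsection \<open>The completely dependent length variables\<close>

text \<open>Closed form of the recursion for the completely dependent length variables: along it the
  value of F_j at v_j never changes, so it can be computed from the first variable.\<close>

definition cd_sticks :: "(nat \<Rightarrow> real) \<Rightarrow> (nat \<Rightarrow> real) \<Rightarrow> real \<Rightarrow> nat \<Rightarrow> real" where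
  "cd_sticks \<alpha> \<beta> x j = beta_quantile (\<alpha> j) (\<beta> j) (beta_cdf (\<alpha> 0) (\<beta> 0) x)"

context
  fixes \<alpha> \<beta> :: "nat \<Rightarrow> real"
  assumes pos: "\<And>j. 0 < \<alpha> j" "\<And>j. 0 < \<beta> j"
begin

lemma cd_sticks_range: "0 \<le> cd_sticks \<alpha> \<beta> x j" "cd_sticks \<alpha> \<beta> x j \<le> 1"
  unfolding cd_sticks_def using pos by (auto intro!: beta_quantile_range beta_cdf_range)

lemma continuous_on_cd_sticks: "continuous_on UNIV (\<lambda>x. cd_sticks \<alpha> \<beta> x)"
  unfolding cd_sticks_def[abs_def] using pos
  by (intro continuous_on_coordinatewise_then_product continuous_on_beta_quantile_comp continuous_on_beta_cdf beta_cdf_range)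

context
  fixes M' :: "'b measure" and P0 :: "'x::topological_space measure" and v' \<theta>'
  assumes cd: "cd_beta_sb M' \<alpha> \<beta> P0 v' \<theta>'"
begin

lemma cd_beta_sb_measurable: "v' j \<in> borel_measurable M'"
proof (induction j)
  case 0
  then show ?case using cd by (simp add: cd_beta_sb_def)
next
  case (Suc j)
  have "continuous_on UNIV (\<lambda>x. beta_quantile (\<alpha> (Suc j)) (\<beta> (Suc j)) (beta_cdf (\<alpha> j) (\<beta> j) x))"
    using pos by (intro continuous_on_beta_quantile_comp continuous_on_beta_cdf beta_cdf_range)
  then have "(\<lambda>\<omega>. beta_quantile (\<alpha> (Suc j)) (\<beta> (Suc j)) (beta_cdf (\<alpha> j) (\<beta> j) (v' j \<omega>))) \<in> borel_measurable M'"
    by (rule borel_measurable_continuous_on) (rule Suc)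
  also have "(\<lambda>\<omega>. beta_quantile (\<alpha> (Suc j)) (\<beta> (Suc j)) (beta_cdf (\<alpha> j) (\<beta> j) (v' j \<omega>))) = v' (Suc j)"
    using cd by (simp add: cd_beta_sb_def fun_eq_iff)
  finally show ?case .
qed

lemma cd_beta_sb_distr: "distr M' borel (v' 0) = beta_measure (\<alpha> 0) (\<beta> 0)"
proof -
  have "distr M' borel (v' 0) = distr M' lborel (v' 0)"
    by (rule distr_cong) auto
  then show ?thesis using cd by (simp add: cd_beta_sb_def)
qed

text \<open>The exceptional set is where \<open>v' 0\<close> leaves the unit interval: there the
  quantile function need not undo the distribution function, and the closed form already fails at
  index 0.\<close>

lemma cd_beta_sb_eq: "AE \<omega> in M'. (\<lambda>j. v' j \<omega>) = cd_sticks \<alpha> \<beta> (v' 0 \<omega>)"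
proof -
  have "AE \<omega> in M'. 0 < v' 0 \<omega> \<and> v' 0 \<omega> < 1"
    using AE_beta_measure[OF pos(1)[of 0] pos(2)[of 0]] cd_beta_sb_measurable
    unfolding cd_beta_sb_distr[symmetric] by (rule AE_distrD[rotated])
  then show ?thesis
  proof eventually_elim
    case (elim \<omega>)
    have "v' j \<omega> = cd_sticks \<alpha> \<beta> (v' 0 \<omega>) j" for j
    proof (induction j)
      case 0
      then show ?case using elim pos by (simp add: cd_sticks_def beta_quantile_cdf)
    next
      case (Suc j)
      have "v' (Suc j) \<omega> = beta_quantile (\<alpha> (Suc j)) (\<beta> (Suc j)) (beta_cdf (\<alpha> j) (\<beta> j) (v' j \<omega>))"
        using cd by (simp add: cd_beta_sb_def)
      then show ?case
        using pos by (simp add: Suc) (simp add: cd_sticks_def beta_cdf_quantile beta_cdf_range)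
    qed
    then show ?case by (rule ext)
  qed
qed

text \<open>Makes limits independent of the space M': only the Beta law of the first length variable
  remains.\<close>

lemma cd_beta_sb_expectation:
  fixes \<Phi> :: "(nat \<Rightarrow> real) \<Rightarrow> real"
  assumes \<Phi>: "continuous_on UNIV \<Phi>"
  shows "(\<integral>\<omega>. \<Phi> (\<lambda>j. v' j \<omega>) \<partial>M') = (\<integral>x. \<Phi> (cd_sticks \<alpha> \<beta> x) \<partial>beta_measure (\<alpha> 0) (\<beta> 0))"
proof -
  note [measurable] = cd_beta_sb_measurable
  have [measurable]: "(\<lambda>x. \<Phi> (cd_sticks \<alpha> \<beta> x)) \<in> borel_measurable borel"
    by (intro borel_measurable_continuous_onI continuous_on_compose2[OF \<Phi> continuous_on_cd_sticks]) auto
  have [measurable]: "(\<lambda>\<omega> j. v' j \<omega>) \<in> borel_measurable M'"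
    by (rule measurable_coordinatewise_then_product) simp
  have [measurable]: "\<Phi> \<in> borel_measurable borel"
    by (rule borel_measurable_continuous_onI[OF \<Phi>])
  have "(\<integral>\<omega>. \<Phi> (\<lambda>j. v' j \<omega>) \<partial>M') = (\<integral>\<omega>. \<Phi> (cd_sticks \<alpha> \<beta> (v' 0 \<omega>)) \<partial>M')"
    by (rule integral_cong_AE) (measurable, use cd_beta_sb_eq in \<open>auto elim!: eventually_mono\<close>)
  also have "\<dots> = (\<integral>x. \<Phi> (cd_sticks \<alpha> \<beta> x) \<partial>beta_measure (\<alpha> 0) (\<beta> 0))"
    unfolding cd_beta_sb_distr[symmetric] by (rule integral_distr[symmetric]) measurable
  finally show ?thesis .
qed

lemma cd_beta_sb_AE_range: "AE \<omega> in M'. \<forall>j. 0 \<le> v' j \<omega> \<and> v' j \<omega> \<le> 1"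
  using cd_beta_sb_eq
proof eventually_elim
  case (elim \<omega>)
  then show ?case using cd_sticks_range by metis
qed

lemma cd_beta_sb_proper:
  assumes H2: "AE u in beta_measure (\<alpha> 0) (\<beta> 0). (\<Sum>j. ennreal (cd_sticks \<alpha> \<beta> u j)) = \<infinity>"
  shows "proper_sb M' v'"
proof -
  have "AE \<omega> in M'. (\<Sum>j. ennreal (cd_sticks \<alpha> \<beta> (v' 0 \<omega>) j)) = \<infinity>"
    using H2 cd_beta_sb_measurable unfolding cd_beta_sb_distr[symmetric] by (rule AE_distrD[rotated])
  then show ?thesis
    unfolding proper_sb_def using cd_beta_sb_eq
    by eventually_elim (simp add: sb_weights_sums_1 cd_sticks_range)
qed

text \<open>Suppose v_{j+1} > v_j. Then F_{j+1}(v_j) < F_{j+1}(v_{j+1}) = F_j(v_j), against the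
  stochastic order in the second Beta parameter, which gives F_j <= F_{j+1}.\<close>

lemma cd_beta_sb_decreasing:
  assumes "\<And>j. \<alpha> j = a" "\<And>j. \<beta> j \<le> \<beta> (Suc j)"
  shows "AE \<omega> in M'. \<forall>j. sb_weights (\<lambda>i. v' i \<omega>) (Suc j) \<le> sb_weights (\<lambda>i. v' i \<omega>) j"
  using cd_beta_sb_AE_range
proof eventually_elim
  case (elim \<omega>)
  show ?case
  proof (intro allI sb_weights_decreasing)
    fix j
    have a: "0 < a" using pos assms(1) by metis
    show "v' (Suc j) \<omega> \<le> v' j \<omega>"
    proof (rule ccontr)
      assume "\<not> ?thesis"
      then have "beta_cdf a (\<beta> (Suc j)) (v' j \<omega>) < beta_cdf a (\<beta> (Suc j)) (v' (Suc j) \<omega>)"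
        using elim by (intro beta_cdf_strict_mono a pos) auto
      also have "v' (Suc j) \<omega> = beta_quantile a (\<beta> (Suc j)) (beta_cdf a (\<beta> j) (v' j \<omega>))"
        using cd assms(1) by (simp add: cd_beta_sb_def)
      also have "beta_cdf a (\<beta> (Suc j)) \<dots> = beta_cdf a (\<beta> j) (v' j \<omega>)"
        using a pos by (simp add: beta_cdf_quantile beta_cdf_range)
      also have "\<dots> \<le> beta_cdf a (\<beta> (Suc j)) (v' j \<omega>)"
        using a pos assms(2) by (intro beta_cdf_mono_snd)
      finally show False by simp
    qed
  qed (use elim in auto)
qed

end

end

subsection \<open>Convergence of the length variables\<close>

text \<open>Gathers what concerns the length variables alone; atoms, base measures and (H2) enter
  only when random measures are treated.\<close>

locale beta_markov_limit =
  fixes M :: "nat \<Rightarrow> 'a measure"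
    and N :: "nat \<Rightarrow> nat"
    and \<alpha>s \<beta>s :: "nat \<Rightarrow> nat \<Rightarrow> real"
    and v :: "nat \<Rightarrow> nat \<Rightarrow> 'a \<Rightarrow> real"
    and \<alpha> \<beta> :: "nat \<Rightarrow> real"
  assumes prob: "\<And>n. prob_space (M n)"
    and chain: "\<And>n. beta_markov_chain (M n) (N n) (\<alpha>s n) (\<beta>s n) (v n)"
    and pos_n: "\<And>n j. 0 < \<alpha>s n j" "\<And>n j. 0 < \<beta>s n j"
    and pos: "\<And>j. 0 < \<alpha> j" "\<And>j. 0 < \<beta> j"
    and N: "filterlim N at_top sequentially"
    and \<alpha>: "\<And>j. (\<lambda>n. \<alpha>s n j) \<longlonglongrightarrow> \<alpha> j"
    and \<beta>: "\<And>j. (\<lambda>n. \<beta>s n j) \<longlonglongrightarrow> \<beta> j"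
begin

lemma v_measurable [measurable]: "v n j \<in> borel_measurable (M n)"
  using chain[of n] by (simp add: beta_markov_chain_def)

lemma AE_range: "AE \<omega> in M n. \<forall>j. 0 < v n j \<omega> \<and> v n j \<omega> < 1"
  by (rule beta_markov_chain_AE_range[OF chain pos_n])

lemma conv_prob_step:
  "conv_prob M (\<lambda>n \<omega>. v n (Suc j) \<omega>) (\<lambda>n \<omega>. bm_Upsilon (\<alpha>s n) (\<beta>s n) j (v n j \<omega>))"
proof (rule conv_probI_square[OF prob])
  have [measurable]: "bm_Upsilon (\<alpha>s n) (\<beta>s n) j \<in> borel_measurable borel" for n
    by (intro borel_measurable_continuous_onI continuous_on_bm_Upsilon pos_n)
  show "(\<lambda>\<omega>. bm_Upsilon (\<alpha>s n) (\<beta>s n) j (v n j \<omega>)) \<in> borel_measurable (M n)" for n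
    by measurable
  have "\<forall>\<^sub>F n in sequentially. 1 \<le> N n"
    using N by (simp add: filterlim_at_top)
  then show "\<forall>\<^sub>F n in sequentially. (\<integral>\<^sup>+\<omega>. ennreal ((v n (Suc j) \<omega> - bm_Upsilon (\<alpha>s n) (\<beta>s n) j (v n j \<omega>))\<^sup>2) \<partial>M n)
     \<le> ennreal ((2 * real (N n) + 2 * (\<alpha>s n (Suc j) + \<beta>s n (Suc j) + 1)\<^sup>2) / (real (N n))\<^sup>2)"
    by eventually_elim (rule beta_markov_chain_step[OF chain pos_n prob])
  have inv: "(\<lambda>n. inverse (real (N n))) \<longlonglongrightarrow> 0"
    by (intro filterlim_compose[OF tendsto_inverse_0_at_top[OF filterlim_real_sequentially] N])
  have "(\<lambda>n. 2 * inverse (real (N n)) + 2 * (\<alpha>s n (Suc j) + \<beta>s n (Suc j) + 1)\<^sup>2 * (inverse (real (N n)))\<^sup>2)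
     \<longlonglongrightarrow> 2 * 0 + 2 * (\<alpha> (Suc j) + \<beta> (Suc j) + 1)\<^sup>2 * 0\<^sup>2"
    by (intro tendsto_intros inv \<alpha> \<beta>)
  also have "(\<lambda>n. 2 * inverse (real (N n)) + 2 * (\<alpha>s n (Suc j) + \<beta>s n (Suc j) + 1)\<^sup>2 * (inverse (real (N n)))\<^sup>2)
     = (\<lambda>n. (2 * real (N n) + 2 * (\<alpha>s n (Suc j) + \<beta>s n (Suc j) + 1)\<^sup>2) / (real (N n))\<^sup>2)"
  proof
    fix n
    \<comment> \<open>Required at every n, also where N n = 0: there both sides are 0 by the
      convention for division by zero.\<close>
    have "2 * inverse x + 2 * c * (inverse x)\<^sup>2 = (2 * x + 2 * c) / x\<^sup>2" for x c :: real
      by (cases "x = 0") (auto simp: field_simps power2_eq_square)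
    then show "2 * inverse (real (N n)) + 2 * (\<alpha>s n (Suc j) + \<beta>s n (Suc j) + 1)\<^sup>2 * (inverse (real (N n)))\<^sup>2
      = (2 * real (N n) + 2 * (\<alpha>s n (Suc j) + \<beta>s n (Suc j) + 1)\<^sup>2) / (real (N n))\<^sup>2" .
  qed
  finally show "(\<lambda>n. (2 * real (N n) + 2 * (\<alpha>s n (Suc j) + \<beta>s n (Suc j) + 1)\<^sup>2) / (real (N n))\<^sup>2) \<longlonglongrightarrow> 0"
    by simp
qed measurable

lemma cdf_uniform_limit:
  obtains c where "c \<longlonglongrightarrow> 0" 
    "\<And>n x. \<bar>beta_cdf (\<alpha>s n j) (\<beta>s n j) x - beta_cdf (\<alpha> j) (\<beta> j) x\<bar> \<le> c n"
  using beta_density_L1_limit[OF \<alpha> \<beta> pos pos_n] beta_cdf_diff[OF pos_n pos] that by blast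

text \<open>Comparing the limiting distribution functions at \<open>v j\<close>, instead of the \<open>v j\<close> themselves, makes
  uniform convergence of the distribution functions sufficient; nothing has to be said about
  convergence of the quantile functions.\<close>

lemma conv_prob_cdf:
  "conv_prob M (\<lambda>n \<omega>. beta_cdf (\<alpha> j) (\<beta> j) (v n j \<omega>)) (\<lambda>n \<omega>. beta_cdf (\<alpha> 0) (\<beta> 0) (v n 0 \<omega>))"
proof (induction j)
  case 0
  show ?case by (rule conv_probI_uniform[where c = "\<lambda>_. 0"]) auto
next
  case (Suc j)
  have [measurable]: "bm_Upsilon (\<alpha>s n) (\<beta>s n) j \<in> borel_measurable borel" for n
    by (intro borel_measurable_continuous_onI continuous_on_bm_Upsilon pos_n)
  have [measurable]: "beta_cdf (\<alpha> i) (\<beta> i) \<in> borel_measurable borel" for i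
    by (intro borel_measurable_continuous_onI continuous_on_beta_cdf pos)
  let ?F = "\<lambda>i. beta_cdf (\<alpha> i) (\<beta> i)" and ?Y = "\<lambda>n \<omega>. bm_Upsilon (\<alpha>s n) (\<beta>s n) j (v n j \<omega>)"
  \<comment> \<open>The limiting distribution function is applied, not the n-th one, because the
    continuous mapping step needs one function for all n.\<close>
  have 1: "conv_prob M (\<lambda>n \<omega>. ?F (Suc j) (v n (Suc j) \<omega>)) (\<lambda>n \<omega>. ?F (Suc j) (?Y n \<omega>))"
  proof (rule conv_prob_continuous[OF prob _ _ _ _ _ _ conv_prob_step])
    show "compact {0..1::real}" by simp
    show "continuous_on {0..1} (?F (Suc j))" by (intro continuous_on_beta_cdf pos)
    show "AE \<omega> in M n. v n (Suc j) \<omega> \<in> {0..1} \<and> ?F (Suc j) (v n (Suc j) \<omega>) = ?F (Suc j) (v n (Suc j) \<omega>)" for n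
      using AE_range[of n] by eventually_elim (auto simp: less_imp_le)
    show "AE \<omega> in M n. ?Y n \<omega> \<in> {0..1} \<and> ?F (Suc j) (?Y n \<omega>) = ?F (Suc j) (?Y n \<omega>)" for n
      by (auto intro!: bm_Upsilon_range pos_n)
  qed measurable
  obtain c1 where c1: "c1 \<longlonglongrightarrow> 0" "\<And>n x. \<bar>beta_cdf (\<alpha>s n j) (\<beta>s n j) x - ?F j x\<bar> \<le> c1 n"
    using cdf_uniform_limit by blast
  obtain c2 where c2: "c2 \<longlonglongrightarrow> 0" "\<And>n x. \<bar>beta_cdf (\<alpha>s n (Suc j)) (\<beta>s n (Suc j)) x - ?F (Suc j) x\<bar> \<le> c2 n"
    using cdf_uniform_limit by blast
  have 2: "conv_prob M (\<lambda>n \<omega>. ?F (Suc j) (?Y n \<omega>)) (\<lambda>n \<omega>. ?F j (v n j \<omega>))"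
  proof (rule conv_probI_uniform)
    fix n \<omega>
    \<comment> \<open>At level n the transition target preserves the distribution function exactly;
      passing to the limiting functions on both sides costs the two uniform errors.\<close>
    have "beta_cdf (\<alpha>s n (Suc j)) (\<beta>s n (Suc j)) (?Y n \<omega>) = beta_cdf (\<alpha>s n j) (\<beta>s n j) (v n j \<omega>)"
      unfolding bm_Upsilon_def by (intro beta_cdf_quantile beta_cdf_range pos_n)
    then show "dist (?F (Suc j) (?Y n \<omega>)) (?F j (v n j \<omega>)) \<le> c1 n + c2 n"
      using c1(2)[of n "v n j \<omega>"] c2(2)[of n "?Y n \<omega>"] by (simp add: dist_real_def abs_if split: if_splits)
    show "(\<lambda>n. c1 n + c2 n) \<longlonglongrightarrow> 0"
      using tendsto_add[OF c1(1) c2(1)] by simp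
  qed
  have "conv_prob M (\<lambda>n \<omega>. ?F (Suc j) (v n (Suc j) \<omega>)) (\<lambda>n \<omega>. ?F j (v n j \<omega>))"
    by (rule conv_prob_trans[OF prob _ _ _ 1 2]) measurable
  then show ?case
    by (rule conv_prob_trans[OF prob _ _ _ _ Suc, rotated -1]) measurable
qed

lemma borel_measurable_cd_sticks [measurable]: "(\<lambda>x. cd_sticks \<alpha> \<beta> x) \<in> borel_measurable borel"
  by (intro borel_measurable_continuous_onI continuous_on_cd_sticks pos)

text \<open>Applying the limiting quantile function, which is uniformly continuous on the unit
  interval, turns merging of the values F_j(v_j) into merging of the v_j themselves.\<close>

lemma conv_prob_sticks:
  "conv_prob M (\<lambda>n \<omega> j. v n j \<omega>) (\<lambda>n \<omega>. cd_sticks \<alpha> \<beta> (v n 0 \<omega>))"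
proof (rule conv_prob_sequence[OF prob])
  have [measurable]: "beta_cdf (\<alpha> i) (\<beta> i) \<in> borel_measurable borel" for i
    by (intro borel_measurable_continuous_onI continuous_on_beta_cdf pos)
  show "(\<lambda>\<omega>. cd_sticks \<alpha> \<beta> (v n 0 \<omega>) j) \<in> borel_measurable (M n)" for n j
    by (rule measurable_product_then_coordinatewise) measurable
  fix j
  show "conv_prob M (\<lambda>n \<omega>. v n j \<omega>) (\<lambda>n \<omega>. cd_sticks \<alpha> \<beta> (v n 0 \<omega>) j)"
  proof (rule conv_prob_continuous[OF prob _ _ _ _ _ _ conv_prob_cdf])
    show "compact {0..1::real}" by simp
    show "continuous_on {0..1} (beta_quantile (\<alpha> j) (\<beta> j))"
      by (intro continuous_on_beta_quantile pos)
    show "AE \<omega> in M n. beta_cdf (\<alpha> j) (\<beta> j) (v n j \<omega>) \<in> {0..1} \<and> 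
        v n j \<omega> = beta_quantile (\<alpha> j) (\<beta> j) (beta_cdf (\<alpha> j) (\<beta> j) (v n j \<omega>))" for n
      using AE_range[of n] by eventually_elim (simp add: beta_quantile_cdf beta_cdf_range pos less_imp_le)
    show "AE \<omega> in M n. beta_cdf (\<alpha> 0) (\<beta> 0) (v n 0 \<omega>) \<in> {0..1} \<and> 
        cd_sticks \<alpha> \<beta> (v n 0 \<omega>) j = beta_quantile (\<alpha> j) (\<beta> j) (beta_cdf (\<alpha> 0) (\<beta> 0) (v n 0 \<omega>))" for n
      by (simp add: cd_sticks_def beta_cdf_range pos)
  qed measurable
qed measurable

lemma expectation_sticks_limit:
  fixes \<Phi> :: "(nat \<Rightarrow> real) \<Rightarrow> real"
  assumes \<Phi>: "continuous_on UNIV \<Phi>" and bound: "\<And>x. \<bar>\<Phi> x\<bar> \<le> B"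
  shows "(\<lambda>n. \<integral>\<omega>. \<Phi> (\<lambda>j. v n j \<omega>) \<partial>M n) \<longlonglongrightarrow> (\<integral>x. \<Phi> (cd_sticks \<alpha> \<beta> x) \<partial>beta_measure (\<alpha> 0) (\<beta> 0))"
proof -
  have [measurable]: "\<Phi> \<in> borel_measurable borel"
    by (rule borel_measurable_continuous_onI[OF \<Phi>])
  have [measurable]: "(\<lambda>\<omega> j. v n j \<omega>) \<in> borel_measurable (M n)" for n
    by (rule measurable_coordinatewise_then_product) simp
  have "conv_prob M (\<lambda>n \<omega>. \<Phi> (\<lambda>j. v n j \<omega>)) (\<lambda>n \<omega>. \<Phi> (cd_sticks \<alpha> \<beta> (v n 0 \<omega>)))"
  proof (rule conv_prob_continuous[OF prob _ _ compact_unit_sequences _ _ _ conv_prob_sticks])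
    show "AE \<omega> in M n. (\<lambda>j. v n j \<omega>) \<in> {x. \<forall>i. 0 \<le> x i \<and> x i \<le> 1} \<and> \<Phi> (\<lambda>j. v n j \<omega>) = \<Phi> (\<lambda>j. v n j \<omega>)" for n
      using AE_range[of n] by eventually_elim (auto simp: less_imp_le)
    show "AE \<omega> in M n. cd_sticks \<alpha> \<beta> (v n 0 \<omega>) \<in> {x. \<forall>i. 0 \<le> x i \<and> x i \<le> 1} \<and>
        \<Phi> (cd_sticks \<alpha> \<beta> (v n 0 \<omega>)) = \<Phi> (cd_sticks \<alpha> \<beta> (v n 0 \<omega>))" for n
      by (simp add: cd_sticks_range pos)
    show "continuous_on {x. \<forall>i. 0 \<le> x i \<and> x i \<le> 1} \<Phi>"
      by (rule continuous_on_subset[OF \<Phi>]) simp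
  qed measurable
  then have 1: "(\<lambda>n. (\<integral>\<omega>. \<Phi> (\<lambda>j. v n j \<omega>) \<partial>M n) - (\<integral>\<omega>. \<Phi> (cd_sticks \<alpha> \<beta> (v n 0 \<omega>)) \<partial>M n)) \<longlonglongrightarrow> 0"
    by (rule conv_prob_expectation[OF prob _ _ _ bound bound, rotated 2]) measurable
  \<comment> \<open>What is left depends on the first length variable only, so the total variation
    bound between its law and the limiting Beta law suffices.\<close>
  have 2: "(\<lambda>n. (\<integral>\<omega>. \<Phi> (cd_sticks \<alpha> \<beta> (v n 0 \<omega>)) \<partial>M n) - (\<integral>x. \<Phi> (cd_sticks \<alpha> \<beta> x) \<partial>beta_measure (\<alpha> 0) (\<beta> 0))) \<longlonglongrightarrow> 0"
  proof (rule Lim_null_comparison)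
    show "(\<lambda>n. B * (\<integral>x. \<bar>beta_density (\<alpha>s n 0) (\<beta>s n 0) x - beta_density (\<alpha> 0) (\<beta> 0) x\<bar> \<partial>lborel)) \<longlonglongrightarrow> 0"
      using tendsto_mult_left[OF beta_density_L1_limit[OF \<alpha> \<beta> pos pos_n], of B 0] by simp
    show "\<forall>\<^sub>F n in sequentially. norm ((\<integral>\<omega>. \<Phi> (cd_sticks \<alpha> \<beta> (v n 0 \<omega>)) \<partial>M n) - (\<integral>x. \<Phi> (cd_sticks \<alpha> \<beta> x) \<partial>beta_measure (\<alpha> 0) (\<beta> 0)))
       \<le> B * (\<integral>x. \<bar>beta_density (\<alpha>s n 0) (\<beta>s n 0) x - beta_density (\<alpha> 0) (\<beta> 0) x\<bar> \<partial>lborel)"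
    proof (rule always_eventually, rule allI)
      fix n
      have "(\<integral>\<omega>. \<Phi> (cd_sticks \<alpha> \<beta> (v n 0 \<omega>)) \<partial>M n) = (\<integral>x. \<Phi> (cd_sticks \<alpha> \<beta> x) \<partial>distr (M n) lborel (v n 0))"
        by (rule integral_distr[symmetric]) measurable
      also have "distr (M n) lborel (v n 0) = beta_measure (\<alpha>s n 0) (\<beta>s n 0)"
        by (rule beta_markov_chain_distr_0[OF chain pos_n])
      finally show "norm ((\<integral>\<omega>. \<Phi> (cd_sticks \<alpha> \<beta> (v n 0 \<omega>)) \<partial>M n) - (\<integral>x. \<Phi> (cd_sticks \<alpha> \<beta> x) \<partial>beta_measure (\<alpha> 0) (\<beta> 0)))
       \<le> B * (\<integral>x. \<bar>beta_density (\<alpha>s n 0) (\<beta>s n 0) x - beta_density (\<alpha> 0) (\<beta> 0) x\<bar> \<partial>lborel)"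
        using beta_measure_integral_diff[of "\<alpha>s n 0" "\<beta>s n 0" "\<alpha> 0" "\<beta> 0" "\<lambda>x. \<Phi> (cd_sticks \<alpha> \<beta> x)" B]
        by (simp add: pos pos_n bound)
    qed
  qed
  show ?thesis
    using tendsto_add[OF 1 2] by (simp add: LIM_zero_iff)
qed

lemma expectation_weights_limit:
  fixes \<Phi> :: "(nat \<Rightarrow> real) \<Rightarrow> real" and M' :: "'b measure"
  assumes \<Phi>: "continuous_on UNIV \<Phi>" and bound: "\<And>x. \<bar>\<Phi> x\<bar> \<le> B"
    and cd: "cd_beta_sb M' \<alpha> \<beta> P0 v' \<theta>'"
  shows "(\<lambda>n. \<integral>\<omega>. \<Phi> (sb_weights (\<lambda>j. v n j \<omega>)) \<partial>M n) \<longlonglongrightarrow> (\<integral>\<omega>. \<Phi> (sb_weights (\<lambda>j. v' j \<omega>)) \<partial>M')"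
proof -
  have cont: "continuous_on UNIV (\<lambda>x. \<Phi> (sb_weights x))"
    by (rule continuous_on_compose2[OF \<Phi> continuous_on_sb_weights]) simp
  show ?thesis
    unfolding cd_beta_sb_expectation[OF pos cd cont]
    by (rule expectation_sticks_limit[OF cont bound])
qed

end

subsection \<open>Integrals against a stick-breaking measure\<close>

text \<open>\<open>measure_of\<close> takes the prescribed values only if they are countably
  additive. This is seen by writing the atomic part as the image under the atoms of a weighted
  counting measure.\<close>

lemma sb_measure_eq:
  fixes P0 :: "'x::topological_space measure" and w :: "nat \<Rightarrow> real" and \<theta> :: "nat \<Rightarrow> 'x"
  assumes "sets P0 = sets borel"
  defines "D \<equiv> distr (density (count_space UNIV) (\<lambda>j. ennreal (w j))) borel \<theta>"
  shows "A \<in> sets borel \<Longrightarrow> emeasure (sb_measure P0 w \<theta>) A = emeasure D A + ennreal (1 - (\<Sum>j. w j)) * emeasure P0 A"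
    and "sets (sb_measure P0 w \<theta>) = sets borel" "space (sb_measure P0 w \<theta>) = UNIV"
proof -
  let ?\<mu> = "\<lambda>A. (\<Sum>j. ennreal (w j) * indicator A (\<theta> j)) + ennreal (1 - (\<Sum>j. w j)) * emeasure P0 A"
  have \<sigma>: "sigma_algebra UNIV (sets borel)"
    using sets.sigma_algebra_axioms[of borel] by simp
  have D: "emeasure D A = (\<Sum>j. ennreal (w j) * indicator A (\<theta> j))" if "A \<in> sets borel" for A
    unfolding D_def using that
    by (simp add: emeasure_distr emeasure_density nn_integral_count_space_nat indicator_def cong: if_cong)
  have [simp]: "sets D = sets borel" by (simp add: D_def)
  have "countably_additive (sets borel) ?\<mu>"
  proof (rule countably_additiveI)
    fix A :: "nat \<Rightarrow> 'x set"
    assume A: "range A \<subseteq> sets borel" "disjoint_family A" "\<Union> (range A) \<in> sets borel"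
    have "(\<Sum>i. ?\<mu> (A i)) = (\<Sum>i. emeasure D (A i) + ennreal (1 - (\<Sum>j. w j)) * emeasure P0 (A i))"
      using A(1) by (intro suminf_cong) (simp add: D range_subsetD)
    also have "\<dots> = (\<Sum>i. emeasure D (A i)) + ennreal (1 - (\<Sum>j. w j)) * (\<Sum>i. emeasure P0 (A i))"
      by (simp add: suminf_add[symmetric])
    also have "\<dots> = emeasure D (\<Union> (range A)) + ennreal (1 - (\<Sum>j. w j)) * emeasure P0 (\<Union> (range A))"
      using A assms(1) by (simp add: suminf_emeasure)
    finally show "(\<Sum>i. ?\<mu> (A i)) = ?\<mu> (\<Union> (range A))"
      using A(3) by (simp add: D)
  qed
  moreover have "positive (sets borel) ?\<mu>" by (simp add: positive_def)
  ultimately show "emeasure (sb_measure P0 w \<theta>) A = emeasure D A + ennreal (1 - (\<Sum>j. w j)) * emeasure P0 A"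
    if "A \<in> sets borel"
    unfolding sb_measure_def D[OF that] using that by (intro emeasure_measure_of_sigma \<sigma>)
  show "sets (sb_measure P0 w \<theta>) = sets borel" "space (sb_measure P0 w \<theta>) = UNIV"
    unfolding sb_measure_def using sigma_algebra.sets_measure_of_eq[OF \<sigma>] by (simp_all add: space_measure_of_conv)
qed

lemma nn_integral_sb_measure:
  assumes P0: "sets P0 = sets borel" and g: "g \<in> borel_measurable borel"
  shows "(\<integral>\<^sup>+x. g x \<partial>sb_measure P0 w \<theta>) = (\<Sum>j. ennreal (w j) * g (\<theta> j)) + ennreal (1 - (\<Sum>j. w j)) * (\<integral>\<^sup>+x. g x \<partial>P0)"
proof -
  define D where "D = distr (density (count_space UNIV) (\<lambda>j. ennreal (w j))) borel \<theta>"
  define c where "c = ennreal (1 - (\<Sum>j. w j))"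
  note [simp, measurable_cong] = P0 sb_measure_eq(2)[OF P0]
  have [simp, measurable_cong]: "sets D = sets borel" by (simp add: D_def)
  have "(\<integral>\<^sup>+x. g x \<partial>sb_measure P0 w \<theta>) = (\<integral>\<^sup>+x. g x \<partial>D) + c * (\<integral>\<^sup>+x. g x \<partial>P0)"
    using g
  proof (induction rule: borel_measurable_induct)
    case (cong f g)
    then have "f = g" by (simp add: fun_eq_iff)
    with cong show ?case by simp
  next
    case (set A)
    then show ?case
      by (simp add: sb_measure_eq(1)[OF P0] D_def[symmetric] c_def)
  next
    case (mult u v)
    then show ?case
      by (simp add: nn_integral_cmult ring_distribs mult_ac)
  next
    case (add u v)
    then show ?case
      by (simp add: nn_integral_add ring_distribs ac_simps)
  next
    case (seq U)
    have 1: "(\<integral>\<^sup>+x. (SUP i. U i) x \<partial>Q) = (SUP i. \<integral>\<^sup>+x. U i x \<partial>Q)" if [simp, measurable_cong]: "sets Q = sets borel" for Q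
      unfolding SUP_apply using seq by (intro nn_integral_monotone_convergence_SUP) auto
    have inc: "incseq (\<lambda>i. \<integral>\<^sup>+x. U i x \<partial>Q)" for Q
      using seq by (auto simp: incseq_def le_fun_def intro!: nn_integral_mono)
    have "(SUP i. (\<integral>\<^sup>+x. U i x \<partial>D) + c * (\<integral>\<^sup>+x. U i x \<partial>P0)) = (SUP i. \<integral>\<^sup>+x. U i x \<partial>D) + (SUP i. c * (\<integral>\<^sup>+x. U i x \<partial>P0))"
      using inc by (intro ennreal_SUP_add) (auto simp: incseq_def intro!: mult_left_mono)
    then have sup: "(SUP i. (\<integral>\<^sup>+x. U i x \<partial>D) + c * (\<integral>\<^sup>+x. U i x \<partial>P0)) = (SUP i. \<integral>\<^sup>+x. U i x \<partial>D) + c * (SUP i. \<integral>\<^sup>+x. U i x \<partial>P0)"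
      by (simp add: SUP_mult_left_ennreal)
    show ?case
      unfolding 1[OF \<open>sets D = sets borel\<close>] 1[OF P0] 1[OF sb_measure_eq(2)[OF P0]] sup[symmetric]
      using seq by simp
  qed
  also have "(\<integral>\<^sup>+x. g x \<partial>D) = (\<Sum>j. ennreal (w j) * g (\<theta> j))"
    unfolding D_def using g by (simp add: nn_integral_distr nn_integral_density nn_integral_count_space_nat)
  finally show ?thesis by (simp add: c_def)
qed

text \<open>Measurability is needed at every point, also on the null set where the weights are no
  probability vector. The series formula for nonnegative integrands holds for arbitrary real
  weights, and its terms are visibly measurable.\<close>

lemma borel_measurable_integral_sb_measure:
  fixes f :: "'x::topological_space \<Rightarrow> real"
  assumes P0: "sets P0 = sets borel" and f [measurable]: "f \<in> borel_measurable borel"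
    and [measurable]: "\<And>j. (\<lambda>\<omega>. w \<omega> j) \<in> borel_measurable M" "\<And>j. \<theta> j \<in> measurable M borel"
  shows "(\<lambda>\<omega>. \<integral>x. f x \<partial>sb_measure P0 (w \<omega>) (\<lambda>j. \<theta> j \<omega>)) \<in> borel_measurable M"
proof -
  define S where "S g \<omega> = (\<Sum>j. ennreal (w \<omega> j) * g (\<theta> j \<omega>)) + ennreal (1 - (\<Sum>j. w \<omega> j)) * (\<integral>\<^sup>+x. g x \<partial>P0)"
    for g and \<omega>
  have S: "(\<integral>\<^sup>+x. g x \<partial>sb_measure P0 (w \<omega>) (\<lambda>j. \<theta> j \<omega>)) = S g \<omega>" if "g \<in> borel_measurable borel" for g \<omega>
    unfolding S_def by (rule nn_integral_sb_measure[OF P0 that])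
  have [measurable]: "S g \<in> borel_measurable M" if [measurable]: "g \<in> borel_measurable borel" for g
    unfolding S_def by measurable
  \<comment> \<open>The value 0 is the default of the integral where \<open>f\<close> is not
    integrable.\<close>
  have "(\<integral>x. f x \<partial>sb_measure P0 (w \<omega>) (\<lambda>j. \<theta> j \<omega>)) = 
     (if S (\<lambda>x. ennreal (norm (f x))) \<omega> < \<infinity> then enn2real (S (\<lambda>x. ennreal (f x)) \<omega>) - enn2real (S (\<lambda>x. ennreal (- f x)) \<omega>) else 0)" for \<omega>
  proof -
    have "f \<in> borel_measurable (sb_measure P0 (w \<omega>) (\<lambda>j. \<theta> j \<omega>))"
      using f by (simp add: measurable_def sb_measure_eq(2,3)[OF P0])
    then have "integrable (sb_measure P0 (w \<omega>) (\<lambda>j. \<theta> j \<omega>)) f \<longleftrightarrow> S (\<lambda>x. ennreal (norm (f x))) \<omega> < \<infinity>"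
      by (simp add: integrable_iff_bounded S)
    then show ?thesis
      by (auto simp: real_lebesgue_integral_def S not_integrable_integral_eq)
  qed
  then show ?thesis by simp
qed

lemma integral_sb_measure:
  fixes f :: "'x::topological_space \<Rightarrow> real"
  assumes P0: "sets P0 = sets borel" and f [measurable]: "f \<in> borel_measurable borel"
    and bound: "\<And>x. \<bar>f x\<bar> \<le> B"
    and w: "\<And>j. 0 \<le> w j" "w sums 1"
  shows "(\<lambda>j. w j * f (\<theta> j)) sums (\<integral>x. f x \<partial>sb_measure P0 w \<theta>)"
proof -
  define D where "D = distr (density (count_space UNIV) (\<lambda>j. ennreal (w j))) borel \<theta>"
  \<comment> \<open>The weights sum to 1, so the coefficient of \<open>P0\<close> vanishes.\<close>
  have "sb_measure P0 w \<theta> = D"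
    by (rule measure_eqI) 
       (use w(2) in \<open>simp_all add: sb_measure_eq[OF P0] D_def sums_iff\<close>)
  then have "(\<integral>x. f x \<partial>sb_measure P0 w \<theta>) = (\<integral>j. f (\<theta> j) \<partial>density (count_space UNIV) (\<lambda>j. ennreal (w j)))"
    by (simp add: D_def integral_distr)
  also have "\<dots> = (\<integral>j. w j * f (\<theta> j) \<partial>count_space UNIV)"
    using w by (subst integral_density) auto
  finally have eq: "(\<integral>x. f x \<partial>sb_measure P0 w \<theta>) = (\<integral>j. w j * f (\<theta> j) \<partial>count_space UNIV)" .
  have "summable (\<lambda>j. norm (w j * f (\<theta> j)))"
  proof (rule summable_comparison_test')
    show "summable (\<lambda>j. w j * B)"
      using w by (intro summable_mult2) (simp add: sums_iff)
    show "norm (norm (w j * f (\<theta> j))) \<le> w j * B" for j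
      using w bound by (simp add: abs_mult mult_left_mono)
  qed
  then show ?thesis
    unfolding eq by (intro sums_integral_count_space_nat) (simp add: integrable_count_space_nat_iff)
qed

lemma integral_sb_measure_truncate:
  fixes f :: "'x::topological_space \<Rightarrow> real"
  assumes P0: "sets P0 = sets borel" and f: "f \<in> borel_measurable borel"
    and bound: "\<And>x. \<bar>f x\<bar> \<le> B"
    and w: "\<And>j. 0 \<le> w j" "w sums 1"
  shows "\<bar>(\<integral>x. f x \<partial>sb_measure P0 w \<theta>) - (\<Sum>j<k. w j * f (\<theta> j))\<bar> \<le> B * (1 - (\<Sum>j<k. w j))"
proof -
  have s: "(\<lambda>j. w (j + k) * f (\<theta> (j + k))) sums ((\<integral>x. f x \<partial>sb_measure P0 w \<theta>) - (\<Sum>j<k. w j * f (\<theta> j)))"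
    by (rule sums_split_initial_segment[OF integral_sb_measure[OF assms]])
  have t: "(\<lambda>j. B * w (j + k)) sums (B * (1 - (\<Sum>j<k. w j)))"
    by (intro sums_mult sums_split_initial_segment w)
  have le: "\<bar>w (j + k) * f (\<theta> (j + k))\<bar> \<le> B * w (j + k)" for j
    using w bound[of "\<theta> (j + k)"] by (simp add: abs_mult mult.commute[of B] mult_left_mono)
  have "(\<integral>x. f x \<partial>sb_measure P0 w \<theta>) - (\<Sum>j<k. w j * f (\<theta> j)) \<le> B * (1 - (\<Sum>j<k. w j))"
    by (rule sums_le[OF _ s t]) (use le in \<open>simp add: abs_le_iff\<close>)
  moreover have "- ((\<integral>x. f x \<partial>sb_measure P0 w \<theta>) - (\<Sum>j<k. w j * f (\<theta> j))) \<le> B * (1 - (\<Sum>j<k. w j))"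
    by (rule sums_le[OF _ sums_minus[OF s] t]) (use le in \<open>simp add: abs_le_iff\<close>)
  ultimately show ?thesis by (simp add: abs_le_iff)
qed

subsection \<open>Characteristic functions\<close>

lemma norm_iexp_diff: "norm (iexp x - iexp y) \<le> \<bar>x - y\<bar>"
proof -
  have "iexp x - iexp y = iexp y * (iexp (x - y) - 1)"
    by (simp add: ring_distribs exp_add[symmetric] algebra_simps)
  then have "norm (iexp x - iexp y) = norm (iexp (x - y) - 1)"
    by (simp add: norm_mult)
  also have "\<dots> \<le> \<bar>x - y\<bar>"
    using iexp_approx1[of "x - y" 0] by simp
  finally show ?thesis .
qed

text \<open>Weights and atoms are independent, so Fubini allows the weights to be frozen. The
  truncated sum is then a sum of independent terms, and a scaling by w j moves into the argument of
  the characteristic function of \<open>f\<close> under \<open>P0\<close>.\<close>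

lemma sb_atoms_truncated_char:
  fixes f :: "'x::topological_space \<Rightarrow> real"
  assumes M: "prob_space M" and atoms: "sb_atoms M P0 v \<theta>"
    and [measurable]: "\<And>j. v j \<in> borel_measurable M" and f [measurable]: "f \<in> borel_measurable borel"
  shows "(\<integral>\<omega>. iexp (t * (\<Sum>j<k. sb_weights (\<lambda>i. v i \<omega>) j * f (\<theta> j \<omega>))) \<partial>M)
     = (\<integral>\<omega>. (\<Prod>j<k. char (distr P0 borel f) (t * sb_weights (\<lambda>i. v i \<omega>) j)) \<partial>M)"
proof -
  interpret prob_space M by fact
  let ?S = "PiM UNIV (\<lambda>_::nat. borel :: real measure)" and ?T = "PiM UNIV (\<lambda>_::nat. borel :: 'x measure)"
  define W where "W \<omega> = (\<lambda>j. sb_weights (\<lambda>i. v i \<omega>) j)" for \<omega>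
  define \<Theta> where "\<Theta> \<omega> = (\<lambda>j. \<theta> j \<omega>)" for \<omega>
  have \<theta> [measurable]: "\<theta> j \<in> measurable M borel" for j
    using atoms by (simp add: sb_atoms_def)
  have \<theta>_distr: "distr M borel (\<theta> j) = P0" for j
    using atoms by (simp add: sb_atoms_def)
  have \<theta>_indep: "indep_vars (\<lambda>_. borel) \<theta> UNIV"
    using atoms by (simp add: sb_atoms_def)
  have W [measurable]: "W \<in> measurable M ?S"
    unfolding W_def sb_weights_def by (rule measurable_PiM_single') (auto simp: space_PiM)
  have \<Theta> [measurable]: "\<Theta> \<in> measurable M ?T"
    unfolding \<Theta>_def by (rule measurable_PiM_single') (auto simp: space_PiM)
  interpret W: prob_space "distr M ?S W" by (rule prob_space_distr) measurable
  interpret \<Theta>: prob_space "distr M ?T \<Theta>" by (rule prob_space_distr) measurable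
  \<comment> \<open>\<open>indep_var\<close> is not applicable: it forces both variables to have the same codomain type.\<close>
  have joint: "distr M ?S W \<Otimes>\<^sub>M distr M ?T \<Theta> = distr M (?S \<Otimes>\<^sub>M ?T) (\<lambda>\<omega>. (W \<omega>, \<Theta> \<omega>))"
  proof (rule pair_measure_eqI)
    fix A B assume "A \<in> sets (distr M ?S W)" "B \<in> sets (distr M ?T \<Theta>)"
    then have [measurable]: "A \<in> sets ?S" "B \<in> sets ?T" by simp_all
    have "indep_set (sets (vimage_algebra (space M) W ?S)) (sets (vimage_algebra (space M) \<Theta> ?T))"
      using atoms by (simp add: sb_atoms_def W_def[abs_def] \<Theta>_def[abs_def])
    then have "prob ((W -` A \<inter> space M) \<inter> (\<Theta> -` B \<inter> space M)) = prob (W -` A \<inter> space M) * prob (\<Theta> -` B \<inter> space M)"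
      by (rule indep_setD) (auto intro!: in_vimage_algebra)
    then show "emeasure (distr M ?S W) A * emeasure (distr M ?T \<Theta>) B
        = emeasure (distr M (?S \<Otimes>\<^sub>M ?T) (\<lambda>\<omega>. (W \<omega>, \<Theta> \<omega>))) (A \<times> B)"
      by (simp add: emeasure_distr emeasure_eq_measure ennreal_mult[symmetric] vimage_Times vimage_comp comp_def Int_ac)
  qed (auto intro: W.sigma_finite_measure_axioms \<Theta>.sigma_finite_measure_axioms)
  interpret WT: pair_prob_space "distr M ?S W" "distr M ?T \<Theta>" ..
  define g where "g w x = iexp (t * (\<Sum>j<k. w j * f (x j)))" for w :: "nat \<Rightarrow> real" and x
  have g [measurable]: "(\<lambda>(w, x). g w x) \<in> borel_measurable (?S \<Otimes>\<^sub>M ?T)"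
    unfolding g_def by measurable
  have int: "integrable (distr M ?S W \<Otimes>\<^sub>M distr M ?T \<Theta>) (\<lambda>(w, x). g w x)"
    by (rule WT.integrable_const_bound[where B = 1]) (auto simp: g_def[abs_def])
  have inner: "(\<integral>x. g w x \<partial>distr M ?T \<Theta>) = (\<Prod>j<k. char (distr P0 borel f) (t * w j))" for w
  proof -
    have "indep_vars (\<lambda>_. borel) (\<lambda>j \<omega>. w j * f (\<theta> j \<omega>)) {..<k}"
      by (rule indep_vars_compose2[OF indep_vars_subset[OF \<theta>_indep]]) auto
    then have "char (distr M borel (\<lambda>\<omega>. \<Sum>j<k. w j * f (\<theta> j \<omega>))) t = (\<Prod>j<k. char (distr M borel (\<lambda>\<omega>. w j * f (\<theta> j \<omega>))) t)"
      by (rule char_distr_sum)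
    moreover have "char (distr M borel (\<lambda>\<omega>. w j * f (\<theta> j \<omega>))) t = char (distr P0 borel f) (t * w j)" for j
      unfolding \<theta>_distr[of j, symmetric] char_def by (simp add: integral_distr mult_ac)
    moreover have "(\<integral>x. g w x \<partial>distr M ?T \<Theta>) = char (distr M borel (\<lambda>\<omega>. \<Sum>j<k. w j * f (\<theta> j \<omega>))) t"
      unfolding char_def by (subst (1 2) integral_distr) (auto simp: g_def[abs_def] \<Theta>_def)
    ultimately show ?thesis by simp
  qed
  have "(\<integral>\<omega>. iexp (t * (\<Sum>j<k. sb_weights (\<lambda>i. v i \<omega>) j * f (\<theta> j \<omega>))) \<partial>M) = (\<integral>\<omega>. (case (W \<omega>, \<Theta> \<omega>) of (w, x) \<Rightarrow> g w x) \<partial>M)"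
    by (simp add: g_def W_def \<Theta>_def)
  also have "\<dots> = (\<integral>z. (case z of (w, x) \<Rightarrow> g w x) \<partial>distr M (?S \<Otimes>\<^sub>M ?T) (\<lambda>\<omega>. (W \<omega>, \<Theta> \<omega>)))"
    by (rule integral_distr[symmetric]) measurable
  also have "\<dots> = (\<integral>w. (\<integral>x. g w x \<partial>distr M ?T \<Theta>) \<partial>distr M ?S W)"
    unfolding joint[symmetric] using WT.integral_fst'[OF int] by simp
  also have "\<dots> = (\<integral>w. (\<Prod>j<k. char (distr P0 borel f) (t * w j)) \<partial>distr M ?S W)"
    by (simp only: inner)
  also have "\<dots> = (\<integral>\<omega>. (\<Prod>j<k. char (distr P0 borel f) (t * W \<omega> j)) \<partial>M)"
  proof (rule integral_distr)
    have "prob_space P0" unfolding \<theta>_distr[of 0, symmetric] by (rule prob_space_distr) simp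
    moreover have [measurable_cong]: "sets P0 = sets borel" unfolding \<theta>_distr[of 0, symmetric] by simp
    ultimately interpret R: real_distribution "distr P0 borel f"
      by (intro prob_space.real_distribution_distr) auto
    show "(\<lambda>w. \<Prod>j<k. char (distr P0 borel f) (t * w j)) \<in> borel_measurable ?S"
      by measurable
  qed measurable
  finally show ?thesis by (simp add: W_def)
qed

subsection \<open>Convergence of the random measures\<close>

lemma tendsto_complex_integral:
  fixes h :: "nat \<Rightarrow> 'a \<Rightarrow> complex" and h' :: "'b \<Rightarrow> complex"
  assumes int: "\<And>n. integrable (M n) (h n)" "integrable M' h'"
    and Re: "(\<lambda>n. \<integral>x. Re (h n x) \<partial>M n) \<longlonglongrightarrow> (\<integral>x. Re (h' x) \<partial>M')"
    and Im: "(\<lambda>n. \<integral>x. Im (h n x) \<partial>M n) \<longlonglongrightarrow> (\<integral>x. Im (h' x) \<partial>M')"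
  shows "(\<lambda>n. \<integral>x. h n x \<partial>M n) \<longlonglongrightarrow> (\<integral>x. h' x \<partial>M')"
  using Re Im int by (simp add: tendsto_complex_iff)

text \<open>Pointwise convergence on a finite net extends to the interval by the common Lipschitz
  constant. Uniformity is needed because the functions will be evaluated at random points.\<close>

lemma equi_lipschitz_pointwise_imp_uniform:
  fixes \<phi>s :: "nat \<Rightarrow> real \<Rightarrow> 'a::real_normed_vector"
  assumes lip: "\<And>n x y. norm (\<phi>s n x - \<phi>s n y) \<le> B * \<bar>x - y\<bar>" "\<And>x y. norm (\<phi> x - \<phi> y) \<le> B * \<bar>x - y\<bar>"
    and lim: "\<And>x. (\<lambda>n. \<phi>s n x) \<longlonglongrightarrow> \<phi> x" and e: "0 < e"
  shows "\<forall>\<^sub>F n in sequentially. \<forall>x\<in>{-T..T}. norm (\<phi>s n x - \<phi> x) < e"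
proof -
  have B: "0 \<le> B" using order_trans[OF norm_ge_zero lip(2)[of 1 0]] by simp
  \<comment> \<open>\<open>B + 1\<close> keeps the denominator positive when \<open>B\<close> is 0,
    and still gives B d <= e/3.\<close>
  define d where "d = e / (3 * (B + 1))"
  have d: "0 < d" "B * d \<le> e / 3" using e B by (auto simp: d_def field_simps)
  obtain D where D: "finite D" "{-T..T} \<subseteq> (\<Union>x\<in>D. ball x d)"
    using compact_Icc[of "-T" T] d(1) unfolding compact_eq_totally_bounded by blast
  have "\<forall>\<^sub>F n in sequentially. \<forall>x\<in>D. norm (\<phi>s n x - \<phi> x) < e / 3"
  proof (intro eventually_ball_finite D ballI)
    show "\<forall>\<^sub>F n in sequentially. norm (\<phi>s n x - \<phi> x) < e / 3" for x
      using tendstoD[OF lim, of "e / 3" x] e by (simp add: dist_norm)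
  qed
  then show ?thesis
  proof eventually_elim
    case (elim n)
    show ?case
    proof
      fix x assume "x \<in> {-T..T}"
      then obtain y where y: "y \<in> D" "\<bar>x - y\<bar> < d"
        using D(2) by (auto simp: dist_real_def abs_minus_commute)
      have le: "B * \<bar>x - y\<bar> \<le> e / 3"
        using y(2) B d(2) by (intro order_trans[OF mult_left_mono[of "\<bar>x - y\<bar>" d]]) auto
      have "norm (\<phi>s n x - \<phi> x) = norm ((\<phi>s n x - \<phi>s n y) + (\<phi>s n y - \<phi> y) + (\<phi> y - \<phi> x))"
        by simp
      also have "\<dots> \<le> norm (\<phi>s n x - \<phi>s n y) + norm (\<phi>s n y - \<phi> y) + norm (\<phi> y - \<phi> x)"
        by (intro order_trans[OF norm_triangle_ineq] add_mono norm_triangle_ineq order_refl)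
      also have "\<dots> < e / 3 + e / 3 + e / 3"
      proof -
        have "norm (\<phi>s n x - \<phi>s n y) \<le> e / 3"
          by (rule order_trans[OF lip(1) le])
        moreover have "norm (\<phi> y - \<phi> x) \<le> e / 3"
          using order_trans[OF lip(2)[of x y] le] by (simp add: norm_minus_commute)
        moreover have "norm (\<phi>s n y - \<phi> y) < e / 3"
          using elim y(1) by blast
        ultimately show ?thesis by linarith
      qed
      finally show "norm (\<phi>s n x - \<phi> x) < e" by simp
    qed
  qed
qed

text \<open>The constant depends on the bound of \<open>f\<close> and not on the measure, so it
  serves all base measures at once.\<close>

lemma char_distr_lipschitz:
  assumes M: "prob_space M" and f [measurable]: "f \<in> borel_measurable M" and bound: "\<And>x. \<bar>f x\<bar> \<le> B"
  shows "norm (char (distr M borel f) s - char (distr M borel f) s') \<le> B * \<bar>s - s'\<bar>"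
proof -
  interpret prob_space M by fact
  have int: "integrable M (\<lambda>x. iexp (s * f x))" for s
    by (rule integrable_const_bound[where B = 1]) auto
  have "norm (char (distr M borel f) s - char (distr M borel f) s') = norm (\<integral>x. iexp (s * f x) - iexp (s' * f x) \<partial>M)"
    using int by (simp add: char_def integral_distr)
  also have "\<dots> \<le> (\<integral>x. norm (iexp (s * f x) - iexp (s' * f x)) \<partial>M)"
    by (rule integral_norm_bound)
  also have "\<dots> \<le> (\<integral>x. B * \<bar>s - s'\<bar> \<partial>M)"
  proof (rule integral_mono)
    show "norm (iexp (s * f x) - iexp (s' * f x)) \<le> B * \<bar>s - s'\<bar>" for x
    proof -
      have "norm (iexp (s * f x) - iexp (s' * f x)) \<le> \<bar>f x\<bar> * \<bar>s - s'\<bar>"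
        using norm_iexp_diff[of "s * f x" "s' * f x"] by (simp add: abs_mult[symmetric] algebra_simps)
      also have "\<dots> \<le> B * \<bar>s - s'\<bar>" by (intro mult_right_mono bound) simp
      finally show ?thesis .
    qed
  qed (intro integrable_norm Bochner_Integration.integrable_diff int, simp)
  also have "\<dots> = B * \<bar>s - s'\<bar>" by (simp add: prob_space)
  finally show ?thesis .
qed

lemma weak_conv_top_imp_char:
  assumes conv: "weak_conv_top Ms M" and prob: "\<And>n. prob_space (Ms n)" "prob_space M"
    and sets: "\<And>n. sets (Ms n) = sets borel" "sets M = sets borel"
    and f: "continuous_on UNIV f"
  shows "(\<lambda>n. char (distr (Ms n) borel f) s) \<longlonglongrightarrow> char (distr M borel f) s"
proof -
  have [measurable]: "f \<in> borel_measurable borel"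
    by (rule borel_measurable_continuous_onI[OF f])
  note [measurable_cong] = sets
  have int: "integrable Q (\<lambda>x. iexp (s * f x))" if "prob_space Q" and [measurable_cong]: "sets Q = sets borel" for Q
    by (rule finite_measure.integrable_const_bound[where B = 1]) (auto intro: prob_space.finite_measure that)
  have "(\<lambda>n. \<integral>x. iexp (s * f x) \<partial>Ms n) \<longlonglongrightarrow> (\<integral>x. iexp (s * f x) \<partial>M)"
  proof (rule tendsto_complex_integral)
    \<comment> \<open>Weak convergence is phrased with real test functions, so cosine and sine are
      tested separately.\<close>
    have cont: "continuous_on UNIV (\<lambda>x. cos (s * f x))" "continuous_on UNIV (\<lambda>x. sin (s * f x))"
      using continuous_on_compose2[OF _ f, of UNIV "\<lambda>y. cos (s * y)"]
        continuous_on_compose2[OF _ f, of UNIV "\<lambda>y. sin (s * y)"]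
      by (simp_all add: continuous_intros)
    have bd: "bounded (range (\<lambda>x. cos (s * f x)))" "bounded (range (\<lambda>x. sin (s * f x)))"
      by (auto intro!: boundedI[where B = 1])
    show "(\<lambda>n. \<integral>x. Re (iexp (s * f x)) \<partial>Ms n) \<longlonglongrightarrow> (\<integral>x. Re (iexp (s * f x)) \<partial>M)"
      "(\<lambda>n. \<integral>x. Im (iexp (s * f x)) \<partial>Ms n) \<longlonglongrightarrow> (\<integral>x. Im (iexp (s * f x)) \<partial>M)"
      using conv[unfolded weak_conv_top_def, rule_format, OF cont(1) bd(1)]
        conv[unfolded weak_conv_top_def, rule_format, OF cont(2) bd(2)]
      by (simp_all add: Re_exp Im_exp)
  qed (intro int prob sets)+
  then show ?thesis
    by (simp add: char_def integral_distr)
qed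

text \<open>The mass left after k sticks, clamped to the unit interval so that it is a bounded
  continuous function on all real sequences. For almost every realisation of proper weights from
  length variables in the unit interval the clamp is inactive.\<close>

definition sb_rest :: "nat \<Rightarrow> (nat \<Rightarrow> real) \<Rightarrow> real" where
  "sb_rest k w = max 0 (min 1 (1 - (\<Sum>j<k. w j)))"

lemma abs_sb_rest_le: "\<bar>sb_rest k w\<bar> \<le> 1"
  by (auto simp: sb_rest_def)

lemma continuous_on_sb_rest: "continuous_on UNIV (sb_rest k)"
  unfolding sb_rest_def[abs_def] by (intro continuous_intros continuous_on_product_coordinates)

lemma borel_measurable_sb_weights:
  assumes [measurable]: "\<And>j. v j \<in> borel_measurable M"
  shows "(\<lambda>\<omega>. sb_weights (\<lambda>i. v i \<omega>)) \<in> borel_measurable M"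
  by (rule measurable_coordinatewise_then_product) (simp add: sb_weights_def)

context
  fixes M :: "'a measure" and v :: "nat \<Rightarrow> 'a \<Rightarrow> real"
  assumes M: "prob_space M"
    and v [measurable]: "\<And>j. v j \<in> borel_measurable M"
    and range: "AE \<omega> in M. \<forall>j. 0 \<le> v j \<omega> \<and> v j \<omega> \<le> 1"
    and proper: "proper_sb M v"
begin

interpretation prob_space M by (rule M)

lemma sb_rest_measurable [measurable]: "(\<lambda>\<omega>. sb_rest k (sb_weights (\<lambda>i. v i \<omega>))) \<in> borel_measurable M"
  by (rule borel_measurable_continuous_on[OF continuous_on_sb_rest borel_measurable_sb_weights]) simp

lemma expectation_sb_rest_tendsto_0: "(\<lambda>k. \<integral>\<omega>. sb_rest k (sb_weights (\<lambda>i. v i \<omega>)) \<partial>M) \<longlonglongrightarrow> 0"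
proof -
  have "(\<lambda>k. \<integral>\<omega>. sb_rest k (sb_weights (\<lambda>i. v i \<omega>)) \<partial>M) \<longlonglongrightarrow> (\<integral>\<omega>. 0 \<partial>M)"
  proof (rule integral_dominated_convergence[where w = "\<lambda>_. 1"])
    show "AE \<omega> in M. (\<lambda>k. sb_rest k (sb_weights (\<lambda>i. v i \<omega>))) \<longlonglongrightarrow> 0"
      using proper unfolding proper_sb_def
    proof eventually_elim
      case (elim \<omega>)
      then have "(\<lambda>k. \<Sum>j<k. sb_weights (\<lambda>i. v i \<omega>) j) \<longlonglongrightarrow> 1" by (simp add: sums_def)
      then have "(\<lambda>k. sb_rest k (sb_weights (\<lambda>i. v i \<omega>))) \<longlonglongrightarrow> max 0 (min 1 (1 - 1))"
        unfolding sb_rest_def by (intro tendsto_intros)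
      then show ?case by simp
    qed
  qed (use abs_sb_rest_le in auto)
  then show ?thesis by simp
qed

text \<open>The map x to exp(i t x) is Lipschitz with constant |t|, and cutting the series after k
  terms costs at most B times the remaining mass. The bound is explicit for each fixed k, so it can
  be used along the whole sequence of processes.\<close>

lemma sb_char_approx:
  fixes f :: "'x::topological_space \<Rightarrow> real"
  assumes atoms: "sb_atoms M P0 v \<theta>" and P0: "sets P0 = sets borel"
    and f [measurable]: "f \<in> borel_measurable borel" and bound: "\<And>x. \<bar>f x\<bar> \<le> B"
  shows "norm (char (distr M borel (\<lambda>\<omega>. \<integral>x. f x \<partial>sb_measure P0 (sb_weights (\<lambda>j. v j \<omega>)) (\<lambda>j. \<theta> j \<omega>))) t
      - (\<integral>\<omega>. (\<Prod>j<k. char (distr P0 borel f) (t * sb_weights (\<lambda>i. v i \<omega>) j)) \<partial>M))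
    \<le> \<bar>t\<bar> * B * (\<integral>\<omega>. sb_rest k (sb_weights (\<lambda>i. v i \<omega>)) \<partial>M)"
proof -
  have [measurable]: "\<theta> j \<in> measurable M borel" for j
    using atoms by (simp add: sb_atoms_def)
  have [measurable]: "(\<lambda>\<omega>. sb_weights (\<lambda>i. v i \<omega>) j) \<in> borel_measurable M" for j
    by (simp add: sb_weights_def)
  define Y where "Y \<omega> = (\<integral>x. f x \<partial>sb_measure P0 (sb_weights (\<lambda>j. v j \<omega>)) (\<lambda>j. \<theta> j \<omega>))" for \<omega>
  define Z where "Z \<omega> = (\<Sum>j<k. sb_weights (\<lambda>i. v i \<omega>) j * f (\<theta> j \<omega>))" for \<omega>
  have [measurable]: "Y \<in> borel_measurable M"
    unfolding Y_def by (rule borel_measurable_integral_sb_measure[OF P0 f]) measurable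
  have [measurable]: "Z \<in> borel_measurable M" unfolding Z_def by measurable
  have int: "integrable M (\<lambda>\<omega>. iexp (t * X \<omega>))" if [measurable]: "X \<in> borel_measurable M" for X
    by (rule integrable_const_bound[where B = 1]) auto
  have YZ: "AE \<omega> in M. \<bar>Y \<omega> - Z \<omega>\<bar> \<le> B * sb_rest k (sb_weights (\<lambda>i. v i \<omega>))"
    using range proper unfolding proper_sb_def
  proof eventually_elim
    case (elim \<omega>)
    let ?w = "sb_weights (\<lambda>i. v i \<omega>)"
    have nonneg: "0 \<le> ?w j" for j using elim(1) by (intro sb_weights_nonneg) auto
    have "(\<Sum>j<k. ?w j) \<le> 1"
      using sum_le_suminf[of ?w "{..<k}"] elim(2) nonneg by (simp add: sums_iff)
    then have "sb_rest k ?w = 1 - (\<Sum>j<k. ?w j)"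
      using sum_nonneg[of "{..<k}" ?w] nonneg by (simp add: sb_rest_def)
    then show ?case
      unfolding Y_def Z_def using integral_sb_measure_truncate[OF P0 f bound nonneg elim(2)] by simp
  qed
  have "norm (char (distr M borel Y) t - (\<integral>\<omega>. iexp (t * Z \<omega>) \<partial>M)) = norm (\<integral>\<omega>. iexp (t * Y \<omega>) - iexp (t * Z \<omega>) \<partial>M)"
    using int by (simp add: char_def integral_distr)
  also have "\<dots> \<le> (\<integral>\<omega>. norm (iexp (t * Y \<omega>) - iexp (t * Z \<omega>)) \<partial>M)"
    by (rule integral_norm_bound)
  also have "\<dots> \<le> (\<integral>\<omega>. \<bar>t\<bar> * B * sb_rest k (sb_weights (\<lambda>i. v i \<omega>)) \<partial>M)"
  proof (rule integral_mono_AE)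
    show "integrable M (\<lambda>\<omega>. norm (iexp (t * Y \<omega>) - iexp (t * Z \<omega>)))"
      by (intro integrable_norm Bochner_Integration.integrable_diff int) simp_all
    show "integrable M (\<lambda>\<omega>. \<bar>t\<bar> * B * sb_rest k (sb_weights (\<lambda>i. v i \<omega>)))"
      by (intro integrable_mult_right integrable_const_bound[where B = 1]) (auto simp: abs_sb_rest_le)
    show "AE \<omega> in M. norm (iexp (t * Y \<omega>) - iexp (t * Z \<omega>)) \<le> \<bar>t\<bar> * B * sb_rest k (sb_weights (\<lambda>i. v i \<omega>))"
      using YZ
    proof eventually_elim
      case (elim \<omega>)
      have "norm (iexp (t * Y \<omega>) - iexp (t * Z \<omega>)) \<le> \<bar>t\<bar> * \<bar>Y \<omega> - Z \<omega>\<bar>"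
        using norm_iexp_diff[of "t * Y \<omega>" "t * Z \<omega>"] by (simp add: abs_mult[symmetric] right_diff_distrib)
      also have "\<dots> \<le> \<bar>t\<bar> * (B * sb_rest k (sb_weights (\<lambda>i. v i \<omega>)))"
        using elim by (rule mult_left_mono) simp
      finally show ?case by simp
    qed
  qed
  also have "\<dots> = \<bar>t\<bar> * B * (\<integral>\<omega>. sb_rest k (sb_weights (\<lambda>i. v i \<omega>)) \<partial>M)"
    by simp
  finally show ?thesis
    unfolding Y_def Z_def sb_atoms_truncated_char[OF M atoms v f] .
qed

end

text \<open>Four errors, e/4 each: truncation at level n, replacing the n-th characteristic function
  of \<open>f\<close> by the limiting one, convergence of the expected product, and truncation in
  the limit.\<close>

lemma (in beta_markov_limit) weak_conv_integral_sb_measure: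
  fixes P0s :: "nat \<Rightarrow> 'x::topological_space measure" and M' :: "'b measure" and f :: "'x \<Rightarrow> real"
  assumes atoms: "\<And>n. sb_atoms (M n) (P0s n) (v n) (\<theta> n)" and proper: "\<And>n. proper_sb (M n) (v n)"
    and P0s: "\<And>n. diffuse_prob (P0s n)" "weak_conv_top P0s P0"
    and cd: "cd_beta_sb M' \<alpha> \<beta> P0 v' \<theta>'" and proper': "proper_sb M' v'"
    and f: "continuous_on UNIV f" "bounded (range f)"
  shows "weak_conv_m
     (\<lambda>n. distr (M n) borel (\<lambda>\<omega>. \<integral>x. f x \<partial>sb_measure (P0s n) (sb_weights (\<lambda>j. v n j \<omega>)) (\<lambda>j. \<theta> n j \<omega>)))
     (distr M' borel (\<lambda>\<omega>. \<integral>x. f x \<partial>sb_measure P0 (sb_weights (\<lambda>j. v' j \<omega>)) (\<lambda>j. \<theta>' j \<omega>)))"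
proof (rule levy_continuity)
  have prob': "prob_space M'" and P0: "diffuse_prob P0" and atoms': "sb_atoms M' P0 v' \<theta>'"
    using cd by (simp_all add: cd_beta_sb_def)
  note v' [measurable] = cd_beta_sb_measurable[OF pos cd]
  interpret M': prob_space M' by (rule prob')
  have f_meas [measurable]: "f \<in> borel_measurable borel"
    by (rule borel_measurable_continuous_onI[OF f(1)])
  have sets: "sets (P0s n) = sets borel" "sets P0 = sets borel" for n
    using P0s(1)[of n] P0 by (simp_all add: diffuse_prob_def)
  note [measurable_cong] = sets
  have P0_prob: "prob_space (P0s n)" "prob_space P0" for n
    using P0s(1)[of n] P0 by (simp_all add: diffuse_prob_def)
  have \<theta>_meas [measurable]: "\<theta> n j \<in> measurable (M n) borel" "\<theta>' j \<in> measurable M' borel" for n j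
    using atoms[of n] atoms' by (simp_all add: sb_atoms_def)
  obtain B where B: "\<And>x. \<bar>f x\<bar> \<le> B"
    using f(2) by (auto simp: bounded_iff)
  have w_meas [measurable]: "(\<lambda>\<omega>. sb_weights (\<lambda>i. v n i \<omega>) j) \<in> borel_measurable (M n)"
    "(\<lambda>\<omega>. sb_weights (\<lambda>i. v' i \<omega>) j) \<in> borel_measurable M'" for n j
    by (simp_all add: sb_weights_def)
  show "real_distribution (distr (M n) borel (\<lambda>\<omega>. \<integral>x. f x \<partial>sb_measure (P0s n) (sb_weights (\<lambda>j. v n j \<omega>)) (\<lambda>j. \<theta> n j \<omega>)))" for n
    by (intro prob_space.real_distribution_distr[OF prob] borel_measurable_integral_sb_measure sets f_meas w_meas \<theta>_meas)
  show "real_distribution (distr M' borel (\<lambda>\<omega>. \<integral>x. f x \<partial>sb_measure P0 (sb_weights (\<lambda>j. v' j \<omega>)) (\<lambda>j. \<theta>' j \<omega>)))"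
    by (intro M'.real_distribution_distr borel_measurable_integral_sb_measure sets f_meas w_meas \<theta>_meas)
  fix t :: real
  define c where "c n = char (distr (M n) borel (\<lambda>\<omega>. \<integral>x. f x \<partial>sb_measure (P0s n) (sb_weights (\<lambda>j. v n j \<omega>)) (\<lambda>j. \<theta> n j \<omega>))) t" for n
  define c' where "c' = char (distr M' borel (\<lambda>\<omega>. \<integral>x. f x \<partial>sb_measure P0 (sb_weights (\<lambda>j. v' j \<omega>)) (\<lambda>j. \<theta>' j \<omega>))) t"
  define \<phi>s where "\<phi>s n = char (distr (P0s n) borel f)" for n
  define \<phi> where "\<phi> = char (distr P0 borel f)"
  interpret \<phi>s: real_distribution "distr (P0s n) borel f" for n
    using P0_prob(1) by (rule prob_space.real_distribution_distr) measurable
  interpret \<phi>: real_distribution "distr P0 borel f"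
    using P0_prob(2) by (rule prob_space.real_distribution_distr) measurable
  have \<phi>_le: "norm (\<phi>s n s) \<le> 1" "norm (\<phi> s) \<le> 1" for n s
    unfolding \<phi>s_def \<phi>_def by (rule \<phi>s.cmod_char_le_1 \<phi>.cmod_char_le_1)+
  have \<phi>_lip: "norm (\<phi>s n s - \<phi>s n s') \<le> B * \<bar>s - s'\<bar>" "norm (\<phi> s - \<phi> s') \<le> B * \<bar>s - s'\<bar>" for n s s'
    unfolding \<phi>s_def \<phi>_def by (intro char_distr_lipschitz P0_prob B; measurable)+
  have \<phi>_lim: "(\<lambda>n. \<phi>s n s) \<longlonglongrightarrow> \<phi> s" for s
    unfolding \<phi>s_def \<phi>_def by (intro weak_conv_top_imp_char P0s P0_prob sets f)
  have \<phi>_cont: "continuous_on UNIV \<phi>"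
    unfolding \<phi>_def by (simp add: continuous_on_eq_continuous_at \<phi>.isCont_char)
  have [measurable]: "\<phi>s n \<in> borel_measurable borel" "\<phi> \<in> borel_measurable borel" for n
    unfolding \<phi>s_def \<phi>_def by simp_all
  \<comment> \<open>Built from the limiting \<open>\<phi>\<close>, because the limit theorem for the
    weights needs one functional for all n.\<close>
  define G where "G k w = (\<Prod>j<k. \<phi> (t * w j))" for k and w :: "nat \<Rightarrow> real"
  have G_cont: "continuous_on UNIV (G k)" for k
    unfolding G_def[abs_def]
    by (intro continuous_on_prod continuous_on_compose2[OF \<phi>_cont] continuous_intros continuous_on_product_coordinates) auto
  have prod_le: "norm (\<Prod>j\<in>J. z j) \<le> 1" if "\<And>j. norm (z j :: complex) \<le> 1" for J and z :: "nat \<Rightarrow> complex"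
    unfolding prod_norm[symmetric] using that by (intro prod_le_1) auto
  have G_le: "norm (G k w) \<le> 1" for k w
    unfolding G_def by (rule prod_le) (rule \<phi>_le)
  let ?w = "\<lambda>n \<omega>. sb_weights (\<lambda>j. v n j \<omega>)" and ?w' = "\<lambda>\<omega>. sb_weights (\<lambda>j. v' j \<omega>)"
  have G_meas [measurable]: "(\<lambda>\<omega>. G k (?w n \<omega>)) \<in> borel_measurable (M n)" "(\<lambda>\<omega>. G k (?w' \<omega>)) \<in> borel_measurable M'" for k n
    unfolding G_def by measurable
  have G_int: "integrable (M n) (\<lambda>\<omega>. G k (?w n \<omega>))" "integrable M' (\<lambda>\<omega>. G k (?w' \<omega>))" for k n
    using G_le
    by (auto intro!: M'.integrable_const_bound[where B = 1]
        finite_measure.integrable_const_bound[OF prob_space.finite_measure[OF prob], where B = 1])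
  have range: "AE \<omega> in M n. \<forall>j. 0 \<le> v n j \<omega> \<and> v n j \<omega> \<le> 1" for n
    using AE_range[of n] by eventually_elim (auto simp: less_imp_le)
  have approx: "norm (c n - (\<integral>\<omega>. (\<Prod>j<k. \<phi>s n (t * ?w n \<omega> j)) \<partial>M n)) \<le> \<bar>t\<bar> * B * (\<integral>\<omega>. sb_rest k (?w n \<omega>) \<partial>M n)" for n k
    unfolding c_def \<phi>s_def
    by (rule sb_char_approx[OF prob v_measurable range proper atoms sets(1) f_meas B])
  have approx': "norm (c' - (\<integral>\<omega>. G k (?w' \<omega>) \<partial>M')) \<le> \<bar>t\<bar> * B * (\<integral>\<omega>. sb_rest k (?w' \<omega>) \<partial>M')" for k
    unfolding c'_def \<phi>_def G_def
    by (rule sb_char_approx[OF prob' v' cd_beta_sb_AE_range[OF pos cd] proper' atoms' sets(2) f_meas B])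
  have rest_lim: "(\<lambda>n. \<integral>\<omega>. sb_rest k (?w n \<omega>) \<partial>M n) \<longlonglongrightarrow> (\<integral>\<omega>. sb_rest k (?w' \<omega>) \<partial>M')" for k
    by (rule expectation_weights_limit[OF continuous_on_sb_rest abs_sb_rest_le cd])
  have G_lim: "(\<lambda>n. \<integral>\<omega>. G k (?w n \<omega>) \<partial>M n) \<longlonglongrightarrow> (\<integral>\<omega>. G k (?w' \<omega>) \<partial>M')" for k
  proof (rule tendsto_complex_integral[OF G_int])
    have "\<bar>Re (G k w)\<bar> \<le> 1" "\<bar>Im (G k w)\<bar> \<le> 1" for w
      using abs_Re_le_cmod[of "G k w"] abs_Im_le_cmod[of "G k w"] G_le[of k w] by linarith+
    then show "(\<lambda>n. \<integral>\<omega>. Re (G k (?w n \<omega>)) \<partial>M n) \<longlonglongrightarrow> (\<integral>\<omega>. Re (G k (?w' \<omega>)) \<partial>M')"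
       "(\<lambda>n. \<integral>\<omega>. Im (G k (?w n \<omega>)) \<partial>M n) \<longlonglongrightarrow> (\<integral>\<omega>. Im (G k (?w' \<omega>)) \<partial>M')"
      by (intro expectation_weights_limit[OF _ _ cd] continuous_intros G_cont; blast)+
  qed
  have "c \<longlonglongrightarrow> c'"
  proof (rule LIMSEQ_I)
    fix e :: real assume e: "0 < e"
    \<comment> \<open>The cut k depends on the limit process only and is fixed before n.\<close>
    have "(\<lambda>k. \<bar>t\<bar> * B * (\<integral>\<omega>. sb_rest k (?w' \<omega>) \<partial>M')) \<longlonglongrightarrow> \<bar>t\<bar> * B * 0"
      by (intro tendsto_mult_left expectation_sb_rest_tendsto_0 prob' v' cd_beta_sb_AE_range[OF pos cd] proper')
    then have "\<forall>\<^sub>F k in sequentially. \<bar>t\<bar> * B * (\<integral>\<omega>. sb_rest k (?w' \<omega>) \<partial>M') < e / 4"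
      using e by (intro order_tendstoD(2)[of _ 0]) auto
    then obtain k where k: "\<bar>t\<bar> * B * (\<integral>\<omega>. sb_rest k (?w' \<omega>) \<partial>M') < e / 4"
      by (auto simp: eventually_sequentially)
    \<comment> \<open>A strict bound in the limit passes to all large n, giving a truncation error
      that is eventually uniform in n.\<close>
    have "\<forall>\<^sub>F n in sequentially. \<bar>t\<bar> * B * (\<integral>\<omega>. sb_rest k (?w n \<omega>) \<partial>M n) < e / 4"
      by (rule order_tendstoD(2)[OF tendsto_mult_left[OF rest_lim] k])
    moreover have "\<forall>\<^sub>F n in sequentially. norm ((\<integral>\<omega>. G k (?w n \<omega>) \<partial>M n) - (\<integral>\<omega>. G k (?w' \<omega>) \<partial>M')) < e / 4"
      using tendstoD[OF G_lim[of k], of "e / 4"] e by (simp add: dist_norm)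
    \<comment> \<open>Almost surely the weights lie in the unit interval, so all arguments are at
      most |t| in absolute value. Products of k factors of norm at most 1 differ by at most the sum
      of the factor differences, hence the division by k; adding 1 covers k = 0.\<close>
    moreover have "\<forall>\<^sub>F n in sequentially. \<forall>s\<in>{-\<bar>t\<bar>..\<bar>t\<bar>}. norm (\<phi>s n s - \<phi> s) < e / (4 * (real k + 1))"
      using e by (intro equi_lipschitz_pointwise_imp_uniform[OF \<phi>_lip \<phi>_lim]) auto
    ultimately have "\<forall>\<^sub>F n in sequentially. norm (c n - c') < e"
    proof eventually_elim
      case (elim n)
      interpret Mn: prob_space "M n" by (rule prob)
      have "norm ((\<integral>\<omega>. (\<Prod>j<k. \<phi>s n (t * ?w n \<omega> j)) \<partial>M n) - (\<integral>\<omega>. G k (?w n \<omega>) \<partial>M n))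
        = norm (\<integral>\<omega>. (\<Prod>j<k. \<phi>s n (t * ?w n \<omega> j)) - G k (?w n \<omega>) \<partial>M n)"
        by (subst Bochner_Integration.integral_diff)
           (auto intro!: G_int Mn.integrable_const_bound[where B = 1] prod_le \<phi>_le)
      also have "\<dots> \<le> (\<integral>\<omega>. norm ((\<Prod>j<k. \<phi>s n (t * ?w n \<omega> j)) - G k (?w n \<omega>)) \<partial>M n)"
        by (rule integral_norm_bound)
      also have "\<dots> \<le> (\<integral>\<omega>. e / 4 \<partial>M n)"
      proof (rule integral_mono_AE)
        show "integrable (M n) (\<lambda>\<omega>. norm ((\<Prod>j<k. \<phi>s n (t * ?w n \<omega> j)) - G k (?w n \<omega>)))"
          by (intro integrable_norm Bochner_Integration.integrable_diff G_int Mn.integrable_const_bound[where B = 1])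
             (auto intro!: prod_le \<phi>_le)
        show "AE \<omega> in M n. norm ((\<Prod>j<k. \<phi>s n (t * ?w n \<omega> j)) - G k (?w n \<omega>)) \<le> e / 4"
          using range[of n] proper[of n] unfolding proper_sb_def
        proof eventually_elim
          case (elim \<omega>)
          have nonneg: "0 \<le> ?w n \<omega> j" for j
            using elim(1) by (intro sb_weights_nonneg) auto
          have le1: "?w n \<omega> j \<le> 1" for j
            using sum_le_suminf[of "?w n \<omega>" "{j}"] elim(2) nonneg by (simp add: sums_iff)
          have "t * ?w n \<omega> j \<in> {-\<bar>t\<bar>..\<bar>t\<bar>}" for j
          proof -
            have "\<bar>t * ?w n \<omega> j\<bar> \<le> \<bar>t\<bar> * 1"
              unfolding abs_mult using nonneg le1 by (intro mult_left_mono) auto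
            then show ?thesis by (auto simp: abs_le_iff)
          qed
          then have *: "norm (\<phi>s n (t * ?w n \<omega> j) - \<phi> (t * ?w n \<omega> j)) \<le> e / (4 * (real k + 1))" for j
            using \<open>\<forall>s\<in>{-\<bar>t\<bar>..\<bar>t\<bar>}. norm (\<phi>s n s - \<phi> s) < e / (4 * (real k + 1))\<close> by (blast intro: less_imp_le)
          have "norm ((\<Prod>j<k. \<phi>s n (t * ?w n \<omega> j)) - G k (?w n \<omega>)) \<le> (\<Sum>j<k. norm (\<phi>s n (t * ?w n \<omega> j) - \<phi> (t * ?w n \<omega> j)))"
            unfolding G_def by (intro norm_prod_diff \<phi>_le)
          also have "\<dots> \<le> (\<Sum>j<k. e / (4 * (real k + 1)))"
            by (intro sum_mono *)
          also have "\<dots> \<le> e / 4"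
            using e by (simp add: field_simps)
          finally show ?case .
        qed
      qed simp
      also have "\<dots> = e / 4" by (simp add: Mn.prob_space)
      finally have 2: "norm ((\<integral>\<omega>. (\<Prod>j<k. \<phi>s n (t * ?w n \<omega> j)) \<partial>M n) - (\<integral>\<omega>. G k (?w n \<omega>) \<partial>M n)) \<le> e / 4" .
      have 1: "norm (c n - (\<integral>\<omega>. (\<Prod>j<k. \<phi>s n (t * ?w n \<omega> j)) \<partial>M n)) < e / 4"
        by (rule le_less_trans[OF approx elim(1)])
      have 4: "norm ((\<integral>\<omega>. G k (?w' \<omega>) \<partial>M') - c') < e / 4"
        using le_less_trans[OF approx' k] by (simp add: norm_minus_commute)
      have tri: "norm (a - d) < e" if "norm (a - b) < e / 4" "norm (b - b') \<le> e / 4" "norm (b' - c) < e / 4" "norm (c - d) < e / 4"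
        for a b b' c d :: complex
      proof -
        have "norm (a - d) \<le> norm (a - b) + norm (b - b') + norm (b' - c) + norm (c - d)"
          using norm_triangle_ineq[of "a - b" "b - d"] norm_triangle_ineq[of "b - b'" "b' - d"] norm_triangle_ineq[of "b' - c" "c - d"]
          by simp
        then show ?thesis using that by linarith
      qed
      show ?case by (rule tri[OF 1 2 elim(2) 4])
    qed
    then show "\<exists>no. \<forall>n\<ge>no. norm (c n - c') < e"
      by (simp add: eventually_sequentially)
  qed
  then show "(\<lambda>n. char (distr (M n) borel (\<lambda>\<omega>. \<integral>x. f x \<partial>sb_measure (P0s n) (sb_weights (\<lambda>j. v n j \<omega>)) (\<lambda>j. \<theta> n j \<omega>))) t)
     \<longlonglongrightarrow> char (distr M' borel (\<lambda>\<omega>. \<integral>x. f x \<partial>sb_measure P0 (sb_weights (\<lambda>j. v' j \<omega>)) (\<lambda>j. \<theta>' j \<omega>))) t"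
    by (simp add: c_def[abs_def] c'_def)
qed

theorem mainTheorem12:
  fixes M :: "nat \<Rightarrow> 'a measure"
    and N :: "nat \<Rightarrow> nat"
    and \<alpha>s \<beta>s :: "nat \<Rightarrow> nat \<Rightarrow> real"
    and P0s :: "nat \<Rightarrow> 'x::polish_space measure"
    and v :: "nat \<Rightarrow> nat \<Rightarrow> 'a \<Rightarrow> real"
    and \<theta> :: "nat \<Rightarrow> nat \<Rightarrow> 'a \<Rightarrow> 'x"
    and \<alpha> \<beta> :: "nat \<Rightarrow> real"
    and P0 :: "'x measure"
  assumes process: "\<And>n. beta_markov_sb (M n) (N n) (\<alpha>s n) (\<beta>s n) (P0s n) (v n) (\<theta> n)"
    and proper: "\<And>n. proper_sb (M n) (v n)"
    and H0: "N 0 = 0" "filterlim N at_top sequentially"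
    and H1: "\<And>j. (\<lambda>n. \<alpha>s n j) \<longlonglongrightarrow> \<alpha> j" "\<And>j. 0 < \<alpha> j"
            "\<And>j. (\<lambda>n. \<beta>s n j) \<longlonglongrightarrow> \<beta> j" "\<And>j. 0 < \<beta> j"
    and H2: "AE u in beta_measure (\<alpha> 0) (\<beta> 0).
               (\<Sum>j. ennreal (beta_quantile (\<alpha> j) (\<beta> j) (beta_cdf (\<alpha> 0) (\<beta> 0) u))) = \<infinity>"
    and H3: "diffuse_prob P0" "weak_conv_top P0s P0"
  shows
    "(prob_space.indep_vars (M 0) (\<lambda>_. lborel) (v 0) UNIV \<and>
      (\<forall>j. distr (M 0) lborel (v 0 j) = beta_measure (\<alpha>s 0 j) (\<beta>s 0 j)) \<and>
      (\<forall>\<sigma> \<tau>. 0 \<le> \<sigma> \<and> \<sigma> < 1 \<and> - \<sigma> < \<tau> \<and>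
          (\<forall>j. \<alpha>s 0 j = 1 - \<sigma> \<and> \<beta>s 0 j = \<tau> + real (Suc j) * \<sigma>) \<longrightarrow>
          pitman_yor_sticks (M 0) \<sigma> \<tau> (v 0)))
     \<and>
     (\<forall>(M' :: 'b measure) v' \<theta>'. cd_beta_sb M' \<alpha> \<beta> P0 v' \<theta>' \<longrightarrow>
        (\<forall>f :: 'x \<Rightarrow> real. continuous_on UNIV f \<longrightarrow> bounded (range f) \<longrightarrow>
           weak_conv_m
             (\<lambda>n. distr (M n) borel
                (\<lambda>\<omega>. \<integral>x. f x \<partial>sb_measure (P0s n) (sb_weights (\<lambda>j. v n j \<omega>)) (\<lambda>j. \<theta> n j \<omega>)))
             (distr M' borel
                (\<lambda>\<omega>. \<integral>x. f x \<partial>sb_measure P0 (sb_weights (\<lambda>j. v' j \<omega>)) (\<lambda>j. \<theta>' j \<omega>)))) \<and>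
        weak_conv_top
          (\<lambda>n. distr (M n) borel (\<lambda>\<omega>. sb_weights (\<lambda>j. v n j \<omega>)))
          (distr M' borel (\<lambda>\<omega>. sb_weights (\<lambda>j. v' j \<omega>))) \<and>
        (\<forall>\<sigma> \<tau>. 0 \<le> \<sigma> \<and> \<sigma> < 1 \<and> - \<sigma> < \<tau> \<and>
            (\<forall>j. \<alpha> j = 1 - \<sigma> \<and> \<beta> j = \<tau> + real (Suc j) * \<sigma>) \<longrightarrow>
            (AE \<omega> in M'. \<forall>j. sb_weights (\<lambda>i. v' i \<omega>) (Suc j) \<le> sb_weights (\<lambda>i. v' i \<omega>) j)))"
proof (intro conjI allI impI)
  have prob: "prob_space (M n)" and pos_n: "0 < \<alpha>s n j" "0 < \<beta>s n j"
    and P0s: "diffuse_prob (P0s n)" and chain: "beta_markov_chain (M n) (N n) (\<alpha>s n) (\<beta>s n) (v n)"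
    and atoms: "sb_atoms (M n) (P0s n) (v n) (\<theta> n)" for n j
    using process[of n] by (auto simp: beta_markov_sb_def)
  note pos = H1(2) H1(4)
  interpret beta_markov_limit M N \<alpha>s \<beta>s v \<alpha> \<beta>
    by (rule beta_markov_limit.intro; rule prob chain pos_n H0(2) H1)
  note indep = beta_markov_chain_0[OF chain[of 0, unfolded H0(1)] pos_n prob]
  show "prob_space.indep_vars (M 0) (\<lambda>_. lborel) (v 0) UNIV"
    by (rule indep)
  show distr: "distr (M 0) lborel (v 0 j) = beta_measure (\<alpha>s 0 j) (\<beta>s 0 j)" for j
    by (rule indep)
  show "pitman_yor_sticks (M 0) \<sigma> \<tau> (v 0)"
    if "0 \<le> \<sigma> \<and> \<sigma> < 1 \<and> - \<sigma> < \<tau> \<and> (\<forall>j. \<alpha>s 0 j = 1 - \<sigma> \<and> \<beta>s 0 j = \<tau> + real (Suc j) * \<sigma>)" for \<sigma> \<tau>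
    using that indep(1) by (simp add: pitman_yor_sticks_def distr)
  fix M' :: "'b measure" and v' \<theta>'
  assume cd: "cd_beta_sb M' \<alpha> \<beta> P0 v' \<theta>'"
  \<comment> \<open>The role of (H2): the limit process loses no mass, which the choice of the
    truncation level relies on.\<close>
  have proper': "proper_sb M' v'"
    using H2 by (intro cd_beta_sb_proper[OF pos cd]) (simp add: cd_sticks_def)
  show "weak_conv_m
     (\<lambda>n. distr (M n) borel (\<lambda>\<omega>. \<integral>x. f x \<partial>sb_measure (P0s n) (sb_weights (\<lambda>j. v n j \<omega>)) (\<lambda>j. \<theta> n j \<omega>)))
     (distr M' borel (\<lambda>\<omega>. \<integral>x. f x \<partial>sb_measure P0 (sb_weights (\<lambda>j. v' j \<omega>)) (\<lambda>j. \<theta>' j \<omega>)))"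
    if "continuous_on UNIV f" "bounded (range f)" for f :: "'x \<Rightarrow> real"
    by (rule weak_conv_integral_sb_measure[OF atoms proper P0s H3(2) cd proper' that])
  show "weak_conv_top (\<lambda>n. distr (M n) borel (\<lambda>\<omega>. sb_weights (\<lambda>j. v n j \<omega>)))
          (distr M' borel (\<lambda>\<omega>. sb_weights (\<lambda>j. v' j \<omega>)))"
    unfolding weak_conv_top_def
  proof (intro allI impI)
    fix \<Phi> :: "(nat \<Rightarrow> real) \<Rightarrow> real"
    assume \<Phi>: "continuous_on UNIV \<Phi>" "bounded (range \<Phi>)"
    then obtain B where "\<And>x. \<bar>\<Phi> x\<bar> \<le> B" by (auto simp: bounded_iff)
    then have "(\<lambda>n. \<integral>\<omega>. \<Phi> (sb_weights (\<lambda>j. v n j \<omega>)) \<partial>M n) \<longlonglongrightarrow> (\<integral>\<omega>. \<Phi> (sb_weights (\<lambda>j. v' j \<omega>)) \<partial>M')"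
      by (rule expectation_weights_limit[OF \<Phi>(1) _ cd])
    then show "(\<lambda>n. \<integral>w. \<Phi> w \<partial>distr (M n) borel (\<lambda>\<omega>. sb_weights (\<lambda>j. v n j \<omega>)))
      \<longlonglongrightarrow> (\<integral>w. \<Phi> w \<partial>distr M' borel (\<lambda>\<omega>. sb_weights (\<lambda>j. v' j \<omega>)))"
      using borel_measurable_continuous_onI[OF \<Phi>(1)]
        borel_measurable_sb_weights[of "v n" "M n" for n] borel_measurable_sb_weights[of v' M']
        cd_beta_sb_measurable[OF pos cd]
      by (simp add: integral_distr)
  qed
  show "AE \<omega> in M'. \<forall>j. sb_weights (\<lambda>i. v' i \<omega>) (Suc j) \<le> sb_weights (\<lambda>i. v' i \<omega>) j"
    if "0 \<le> \<sigma> \<and> \<sigma> < 1 \<and> - \<sigma> < \<tau> \<and> (\<forall>j. \<alpha> j = 1 - \<sigma> \<and> \<beta> j = \<tau> + real (Suc j) * \<sigma>)" for \<sigma> \<tau>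
    \<comment> \<open>Consecutive second parameters differ by \<open>\<sigma>\<close>, which is
      nonnegative, and the first parameter is constant.\<close>
    using that by (intro cd_beta_sb_decreasing[OF pos cd, of "1 - \<sigma>"]) (auto simp: distrib_right)
qed

end
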